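(* Let $(\mathcal{N}\cup\{0\},\mathcal{E})$ be a radial distribution network with net nodal consumptions $(p_i,q_i)_{i\in\mathcal{N}}$ satisfying the No Reverse Power Flow (NRPF) condition. Let $(P,Q,\nu,\ell)$ be the network state computed with the nonlinear power flow (NPF) constraints and $(\hat P,\hat Q,\hat\nu,\hat\ell)$ the one computed with the linear power flow (LPF) constraints, both regarded as functions of $(p_i,q_i)_{i\in\mathcal{N}}$. Then: (1) each flow quantity $f$ computed using NPF (resp. $\hat f$ computed using LPF) is increasing (resp. non-decreasing) in every net nodal consumption quantity; (2) each nodal voltage quantity $v$ (NPF) and $\hat v$ (LPF) is strictly decreasing in every net nodal consumption quantity; (3) the impact of a change in consumption is greater on the NPF values than on the LPF values, i.e. $$\frac{\partial f}{\partial c}\;\ge\;\frac{\partial \hat f}{\partial c}\;\ge\;0\;>\;\frac{\partial \hat v}{\partial c}\;>\;\frac{\partial v}{\partial c}$$ for all $(f,\hat f)\in\mathcal{H}$, all $(v,\hat v)\in\mathcal{I}$ and all $c\in\mathcal{M}$, where $\mathcal{H}=\{(P_{ij},\hat P_{ij}),(Q_{ij},\hat Q_{ij}),(\ell_{ij},\hat\ell_{ij})\}_{(i,j)\in\mathcal{E}}$, $\mathcal{I}=\{(\nu_i,\hat\nu_i)\}_{i\in\mathcal{N}}$ and $\mathcal{M}=\{p_i,q_i\}_{i\in\mathcal{N}}$.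
   Context: The distribution network (DN) is a tree with node set $\mathcal{N}\cup\{0\}$, rooted at the substation node $0$, and edge set $\mathcal{E}$; $(i,j)\in\mathcal{E}$ means that $i$ is the parent of $j$. Line $(i,j)$ has resistance $r_{ij}$ and reactance $x_{ij}$. Lines have positive but small impedances: $0<r_{ij}\ll 1$, $0<x_{ij}\ll 1$. Net active and reactive consumption at node $i$ are $p_i,q_i$. $P_{ij},Q_{ij}$ are the active and reactive power flows on line $(i,j)$, $\ell_{ij}$ is the squared current magnitude on it, and $\nu_i$ is the squared voltage magnitude at node $i$. $\nu^{nom}$ is the nominal squared voltage (1 pu) and $\Delta\nu_0$ is a given constant (drop in the substation voltage). NPF constraints: $\nu_0=\nu^{nom}-\Delta\nu_0$ and, for all $(i,j)\in\mathcal{E}$, $$P_{ij}=\sum_{k:(j,k)\in\mathcal{E}}P_{jk}+p_j+r_{ij}\ell_{ij},\qquad Q_{ij}=\sum_{k:(j,k)\in\mathcal{E}}Q_{jk}+q_j+x_{ij}\ell_{ij},$$ $$\nu_j=\nu_i-2r_{ij}P_{ij}-2x_{ij}Q_{ij}+(r_{ij}^2+x_{ij}^2)\ell_{ij},\qquad \ell_{ij}\nu_i=P_{ij}^2+Q_{ij}^2.$$ The NPF solution for fixed $(p,q)$ is the solution of the convex relaxation in which the last equality is replaced by $\ell_{ij}\nu_i\ge P_{ij}^2+Q_{ij}^2$ and the quantity $W^{VR}\max_{i\in\mathcal{N}}|\nu^{nom}-\nu_i|+\sum_{(i,j)\in\mathcal{E}}r_{ij}\ell_{ij}$ is minimized (with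 $W^{VR}\ge 0$ a constant); under NRPF this solution is unique and satisfies the relaxed inequality with equality (known fact used as a standing convention). LPF constraints: $\hat\nu_0=\nu^{nom}-\Delta\nu_0$ and, for all $(i,j)\in\mathcal{E}$, $$\hat P_{ij}=\sum_{k:(j,k)\in\mathcal{E}}\hat P_{jk}+p_j,\quad \hat Q_{ij}=\sum_{k:(j,k)\in\mathcal{E}}\hat Q_{jk}+q_j,\quad \hat\nu_j=\hat\nu_i-2(r_{ij}\hat P_{ij}+x_{ij}\hat Q_{ij}),\quad \hat\ell_{ij}\hat\nu_i=\hat P_{ij}^2+\hat Q_{ij}^2.$$ NRPF condition: letting $\mathcal{N}_i\subseteq\mathcal{N}$ be the set of nodes of the subtree rooted at $i$ (including $i$), $\sum_{j\in\mathcal{N}_i}p_j\ge 0$ and $\sum_{j\in\mathcal{N}_i}q_j\ge 0$ for all $i\in\mathcal{N}$. Flow quantities are $P_{ij},Q_{ij},\ell_{ij}$ (and their hatted LPF versions); voltage quantities are $\nu_i$, $i\in\mathcal{N}$ (and hatted versions); net nodal consumption quantities are $p_i,q_i$, $i\in\mathcal{N}$.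
   Formalization: Strict claims need the consumption in the same feeder (same child of node 0); strict NPF flow growth also needs it in, or load on, the line's subtree; ∂v̂/∂c>∂v/∂c needs a loaded feeder. Takes 0≤Δν₀<ν^nom and impedances below a threshold depending on a bound on loads. *)

theory Defs
  imports Complex_Main
begin

(* z is the substation; an edge (i, j) points from the parent i to the child j. *)
definition radial_network :: "'n set \<Rightarrow> 'n \<Rightarrow> ('n \<times> 'n) set \<Rightarrow> bool" where
  "radial_network N z E \<longleftrightarrow>
     finite N \<and> z \<notin> N \<and> E \<subseteq> insert z N \<times> N \<and>
     (\<forall>j\<in>N. \<exists>!i. (i, j) \<in> E) \<and> (\<forall>j\<in>N. (z, j) \<in> E\<^sup>+)"

definition subtree :: "('n \<times> 'n) set \<Rightarrow> 'n \<Rightarrow> 'n set" where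
  "subtree E i = E\<^sup>* `` {i}"

(* All nodes hanging below the same child of the substation as i.  Since the substation voltage is
   held fixed, consumption outside this set has no influence at i. *)
definition feeder :: "'n \<Rightarrow> ('n \<times> 'n) set \<Rightarrow> 'n \<Rightarrow> 'n set" where
  "feeder z E i = {k. \<exists>a. (z, a) \<in> E \<and> i \<in> subtree E a \<and> k \<in> subtree E a}"

(* The coordinates of a consumption vector d: p_i = d (Active i) and q_i = d (Reactive i). *)
datatype 'n consumption = Active (node_of: 'n) | Reactive (node_of: 'n)

definition nrpf :: "'n set \<Rightarrow> ('n \<times> 'n) set \<Rightarrow> ('n consumption \<Rightarrow> real) \<Rightarrow> bool" where
  "nrpf N E d \<longleftrightarrow>
     (\<forall>i\<in>N. 0 \<le> (\<Sum>j\<in>subtree E i. d (Active j)) \<and> 0 \<le> (\<Sum>j\<in>subtree E i. d (Reactive j)))"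

definition loaded :: "('n consumption \<Rightarrow> real) \<Rightarrow> 'n set \<Rightarrow> bool" where
  "loaded d A \<longleftrightarrow> (\<exists>j\<in>A. d (Active j) \<noteq> 0 \<or> d (Reactive j) \<noteq> 0)"

(* Active flow P, reactive flow Q, squared current magnitude, squared voltage magnitude. *)
record 'n flow_state =
  flowP :: "'n \<times> 'n \<Rightarrow> real"
  flowQ :: "'n \<times> 'n \<Rightarrow> real"
  curr :: "'n \<times> 'n \<Rightarrow> real"
  volt :: "'n \<Rightarrow> real"

(* The affine part of NPF; v0 is the squared substation voltage. *)
definition npf_affine ::
  "'n \<Rightarrow> ('n \<times> 'n) set \<Rightarrow> ('n \<times> 'n \<Rightarrow> real) \<Rightarrow> ('n \<times> 'n \<Rightarrow> real) \<Rightarrow> real \<Rightarrow>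
   ('n consumption \<Rightarrow> real) \<Rightarrow> 'n flow_state \<Rightarrow> bool" where
  "npf_affine z E r x v0 d s \<longleftrightarrow>
     volt s z = v0 \<and>
     (\<forall>(i, j)\<in>E.
        flowP s (i, j) = (\<Sum>k | (j, k) \<in> E. flowP s (j, k)) + d (Active j) + r (i, j) * curr s (i, j) \<and>
        flowQ s (i, j) = (\<Sum>k | (j, k) \<in> E. flowQ s (j, k)) + d (Reactive j) + x (i, j) * curr s (i, j) \<and>
        volt s j = volt s i - 2 * r (i, j) * flowP s (i, j) - 2 * x (i, j) * flowQ s (i, j)
                   + ((r (i, j))\<^sup>2 + (x (i, j))\<^sup>2) * curr s (i, j))"

definition npf_constraints ::
  "'n \<Rightarrow> ('n \<times> 'n) set \<Rightarrow> ('n \<times> 'n \<Rightarrow> real) \<Rightarrow> ('n \<times> 'n \<Rightarrow> real) \<Rightarrow> real \<Rightarrow>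
   ('n consumption \<Rightarrow> real) \<Rightarrow> 'n flow_state \<Rightarrow> bool" where
  "npf_constraints z E r x v0 d s \<longleftrightarrow>
     npf_affine z E r x v0 d s \<and>
     (\<forall>(i, j)\<in>E. curr s (i, j) * volt s i = (flowP s (i, j))\<^sup>2 + (flowQ s (i, j))\<^sup>2)"

(* The sign conditions express that curr and volt are squared magnitudes; without them the relaxed
   inequality would not describe a convex (rotated second-order) cone. *)
definition npf_relaxed ::
  "'n set \<Rightarrow> 'n \<Rightarrow> ('n \<times> 'n) set \<Rightarrow> ('n \<times> 'n \<Rightarrow> real) \<Rightarrow> ('n \<times> 'n \<Rightarrow> real) \<Rightarrow> real \<Rightarrow>
   ('n consumption \<Rightarrow> real) \<Rightarrow> 'n flow_state \<Rightarrow> bool" where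
  "npf_relaxed N z E r x v0 d s \<longleftrightarrow>
     npf_affine z E r x v0 d s \<and>
     (\<forall>(i, j)\<in>E. curr s (i, j) * volt s i \<ge> (flowP s (i, j))\<^sup>2 + (flowQ s (i, j))\<^sup>2) \<and>
     (\<forall>e\<in>E. 0 \<le> curr s e) \<and> (\<forall>i\<in>insert z N. 0 \<le> volt s i)"

definition npf_cost ::
  "'n set \<Rightarrow> ('n \<times> 'n) set \<Rightarrow> ('n \<times> 'n \<Rightarrow> real) \<Rightarrow> real \<Rightarrow> real \<Rightarrow> 'n flow_state \<Rightarrow> real" where
  "npf_cost N E r vnom W s =
     W * Max ((\<lambda>i. \<bar>vnom - volt s i\<bar>) ` N) + (\<Sum>e\<in>E. r e * curr s e)"

(* dv is the drop of the (squared) substation voltage below the nominal value vnom. *)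
definition npf_solution ::
  "'n set \<Rightarrow> 'n \<Rightarrow> ('n \<times> 'n) set \<Rightarrow> ('n \<times> 'n \<Rightarrow> real) \<Rightarrow> ('n \<times> 'n \<Rightarrow> real) \<Rightarrow>
   real \<Rightarrow> real \<Rightarrow> real \<Rightarrow> ('n consumption \<Rightarrow> real) \<Rightarrow> 'n flow_state \<Rightarrow> bool" where
  "npf_solution N z E r x vnom dv W d s \<longleftrightarrow>
     npf_relaxed N z E r x (vnom - dv) d s \<and>
     (\<forall>s'. npf_relaxed N z E r x (vnom - dv) d s' \<longrightarrow>
           npf_cost N E r vnom W s \<le> npf_cost N E r vnom W s')"

definition lpf_constraints ::
  "'n \<Rightarrow> ('n \<times> 'n) set \<Rightarrow> ('n \<times> 'n \<Rightarrow> real) \<Rightarrow> ('n \<times> 'n \<Rightarrow> real) \<Rightarrow> real \<Rightarrow>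
   ('n consumption \<Rightarrow> real) \<Rightarrow> 'n flow_state \<Rightarrow> bool" where
  "lpf_constraints z E r x v0 d s \<longleftrightarrow>
     volt s z = v0 \<and>
     (\<forall>(i, j)\<in>E.
        flowP s (i, j) = (\<Sum>k | (j, k) \<in> E. flowP s (j, k)) + d (Active j) \<and>
        flowQ s (i, j) = (\<Sum>k | (j, k) \<in> E. flowQ s (j, k)) + d (Reactive j) \<and>
        volt s j = volt s i - 2 * (r (i, j) * flowP s (i, j) + x (i, j) * flowQ s (i, j)) \<and>
        curr s (i, j) * volt s i = (flowP s (i, j))\<^sup>2 + (flowQ s (i, j))\<^sup>2)"

(* SOME rather than THE: the components of a state are total functions, so a solution is determined
   on the lines and nodes of the network but not outside it. *)
definition npf_state ::
  "'n set \<Rightarrow> 'n \<Rightarrow> ('n \<times> 'n) set \<Rightarrow> ('n \<times> 'n \<Rightarrow> real) \<Rightarrow> ('n \<times> 'n \<Rightarrow> real) \<Rightarrow>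
   real \<Rightarrow> real \<Rightarrow> real \<Rightarrow> ('n consumption \<Rightarrow> real) \<Rightarrow> 'n flow_state" where
  "npf_state N z E r x vnom dv W d = (SOME s. npf_solution N z E r x vnom dv W d s)"

definition lpf_state ::
  "'n \<Rightarrow> ('n \<times> 'n) set \<Rightarrow> ('n \<times> 'n \<Rightarrow> real) \<Rightarrow> ('n \<times> 'n \<Rightarrow> real) \<Rightarrow> real \<Rightarrow> real \<Rightarrow>
   ('n consumption \<Rightarrow> real) \<Rightarrow> 'n flow_state" where
  "lpf_state z E r x vnom dv d = (SOME s. lpf_constraints z E r x (vnom - dv) d s)"

(* NRPF consumption vectors of size below M.  The bound is needed because impedances that are small
   enough for NPF to be solvable cannot be chosen uniformly over all loads.  As the bound is strict
   and NRPF is preserved by increasing a coordinate, for d in this set and c a coordinate of a node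
   in N, {t. d(c := t) \<in> admissible N E M} contains a right neighbourhood of d c, so that derivatives
   within that set are unique. *)
definition admissible :: "'n set \<Rightarrow> ('n \<times> 'n) set \<Rightarrow> real \<Rightarrow> ('n consumption \<Rightarrow> real) set" where
  "admissible N E M = {d. nrpf N E d \<and> (\<forall>c. node_of c \<in> N \<longrightarrow> \<bar>d c\<bar> < M)}"

end

theory Submission
  imports Defs
begin

text \<open>Index the line into node \<open>j\<close> by \<open>j\<close>.  Flows are subtree sums and voltages are path sums, so both
  are affine in the consumption and the squared currents, flows increasing and voltages decreasing.
  The map sending a current vector to \<open>(P\<^sup>2 + Q\<^sup>2) / \<nu>\<close> is therefore monotone, and for small
  impedances it preserves a box; its least fixed point lies below the currents of every relaxed state.
  As under NRPF the cost increases with the currents, that fixed point is the unique NPF solution, and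
  leastness makes it monotone in the consumption.  Its derivative \<open>m\<close> is a nonnegative solution of the
  linearised equation, and the losses due to \<open>m\<close> are exactly what NPF adds to the LPF derivatives
  of flows and voltages.\<close>

text \<open>The fixed point comes from order and not from contraction because it is compared with
  relaxed states, whose currents have no bound fixed beforehand, and because leastness also compares
  two loads directly. Contraction serves only the linear problems, where it bounds the difference
  quotients and makes them converge. These quotients are estimated by hand: the currents are
  characterised on admissible loads only, and a load on the boundary of the NRPF cone may admit
  change in one direction only. All constants depend on the number of nodes, on \<open>M\<close> and
  on the substation voltage alone, so one impedance bound serves every admissible load. Strictness
  has one source: the losses of a line enter its own flows and leave a positive surplus in its
  voltage drop once the current responds. On a feeder without load the flows and currents are zero,
  hence so is \<open>m\<close>, and the NPF and LPF voltage derivatives coincide; this is where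
  \<open>loaded\<close> comes from.\<close>

lemma least_fixpoint_box:
  fixes G :: "('i \<Rightarrow> real) \<Rightarrow> 'i \<Rightarrow> real"
  assumes mono: "\<And>u v. (\<forall>j\<in>I. 0 \<le> u j \<and> u j \<le> v j \<and> v j \<le> L) \<Longrightarrow> \<forall>j\<in>I. G u j \<le> G v j"
    and box: "\<And>u. (\<forall>j\<in>I. 0 \<le> u j \<and> u j \<le> L) \<Longrightarrow> \<forall>j\<in>I. 0 \<le> G u j \<and> G u j \<le> L"
    and L: "0 \<le> L"
  shows "\<exists>l. (\<forall>j\<in>I. 0 \<le> l j \<and> l j \<le> L \<and> G l j = l j) \<and>
             (\<forall>y. (\<forall>j\<in>I. 0 \<le> y j \<and> y j \<le> L \<and> G y j \<le> y j) \<longrightarrow> (\<forall>j\<in>I. l j \<le> y j))"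
proof -
  \<comment> \<open>Knaster-Tarski in a product of intervals: the pointwise infimum of all pre-fixed
    points. The constant \<open>L\<close> is one of them, so the infima are over nonempty
    sets.\<close>
  define S where "S = {y. \<forall>j\<in>I. 0 \<le> y j \<and> y j \<le> L \<and> G y j \<le> y j}"
  define l where "l j = Inf ((\<lambda>y. y j) ` S)" for j
  have top: "(\<lambda>_. L) \<in> S" using box[of "\<lambda>_. L"] L by (auto simp: S_def)
  have bdd: "bdd_below ((\<lambda>y. y j) ` S)" if "j \<in> I" for j
    using that by (auto simp: S_def intro!: bdd_belowI[where m = 0])
  have lower: "l j \<le> y j" if "y \<in> S" "j \<in> I" for y j
    unfolding l_def using that by (auto intro!: cInf_lower bdd)
  have l0: "0 \<le> l j" if "j \<in> I" for j
    unfolding l_def using that top by (intro cInf_greatest) (auto simp: S_def)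
  have lL: "l j \<le> L" if "j \<in> I" for j using lower[OF top that] .
  have pre: "G l j \<le> l j" if j: "j \<in> I" for j
    unfolding l_def[of j]
  proof (rule cInf_greatest)
    fix a assume "a \<in> (\<lambda>y. y j) ` S"
    then obtain y where y: "y \<in> S" "a = y j" by auto
    have "\<forall>i\<in>I. G l i \<le> G y i"
      using y(1) by (intro mono) (auto simp: l0 lower, auto simp: S_def)
    then show "G l j \<le> a" using y j by (fastforce simp: S_def)
  qed (use top in auto)
  have G1: "\<forall>j\<in>I. 0 \<le> G l j \<and> G l j \<le> L" by (rule box) (auto simp: l0 lL)
  have "\<forall>j\<in>I. G (G l) j \<le> G l j" using G1 by (intro mono) (auto simp: pre lL)
  \<comment> \<open>The image of a pre-fixed point is again one, so \<open>l\<close> lies below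
    \<open>G l\<close>; this is the missing half of the fixed point equation.\<close>
  then have "G l \<in> S" using G1 by (auto simp: S_def)
  then have "G l j = l j" if "j \<in> I" for j using lower[of "G l" j] pre that by fastforce
  then show ?thesis using l0 lL lower by (intro exI[of _ l]) (auto simp: S_def)
qed

text \<open>Apply the hypothesis at an index where \<open>\<bar>y k\<bar>\<close> attains its
  maximum \<open>c\<close>: then \<open>c \<le> c / 2 + b\<close>, so \<open>c \<le> 2 * b\<close>.
  This is the a priori estimate for a linear system that contracts by one half in the maximum
  norm.\<close>

lemma half_contraction_bound:
  fixes y :: "'i \<Rightarrow> real"
  assumes "finite I"
    and contr: "\<And>c j. \<lbrakk>j \<in> I; \<forall>k\<in>I. \<bar>y k\<bar> \<le> c\<rbrakk> \<Longrightarrow> \<bar>y j\<bar> \<le> c / 2 + b"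
    and j: "j \<in> I"
  shows "\<bar>y j\<bar> \<le> 2 * b"
proof -
  define c where "c = Max ((\<lambda>k. \<bar>y k\<bar>) ` I)"
  have le: "\<forall>k\<in>I. \<bar>y k\<bar> \<le> c" using assms(1) by (auto simp: c_def)
  have "c \<in> (\<lambda>k. \<bar>y k\<bar>) ` I" unfolding c_def using assms(1) j by (intro Max_in) auto
  then obtain k where "k \<in> I" "c = \<bar>y k\<bar>" by auto
  then have "c \<le> c / 2 + b" using contr[of k c] le by simp
  then show ?thesis using le j by fastforce
qed

lemma abs_add3_le:
  fixes a b c :: real
  assumes "\<bar>a\<bar> \<le> A" "\<bar>b\<bar> \<le> B" "\<bar>c\<bar> \<le> C"
  shows "\<bar>a + b + c\<bar> \<le> A + B + C"
  using assms by linarith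

text \<open>The NPF and LPF states agree with their explicit formulas for admissible loads only, so
  derivatives have to be transferred within \<open>T\<close>, the point \<open>a\<close>
  included.\<close>

lemma has_real_derivative_cong_on:
  assumes "(f has_real_derivative D) (at a within T)" "a \<in> T" "\<And>t. t \<in> T \<Longrightarrow> f t = g t"
  shows "(g has_real_derivative D) (at a within T)"
  using assms by (intro has_field_derivative_transform_within[OF assms(1) zero_less_one]) auto

subsection \<open>Radial networks\<close>

locale radial =
  fixes N :: "'n set" and z :: 'n and E :: "('n \<times> 'n) set"
    and r x :: "'n \<times> 'n \<Rightarrow> real"
  assumes radial: "radial_network N z E"
    and r_pos: "\<And>e. e \<in> E \<Longrightarrow> 0 < r e" and x_pos: "\<And>e. e \<in> E \<Longrightarrow> 0 < x e"
begin

definition par :: "'n \<Rightarrow> 'n" where "par j = (THE i. (i, j) \<in> E)"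

text \<open>For a node of the network this is the path from the root, with the node itself but
  without the root; under the indexing of lines it is the set of lines on that path.\<close>

definition anc :: "'n \<Rightarrow> 'n set" where "anc i = {k \<in> N. i \<in> subtree E k}"

lemma finN: "finite N" and zN: "z \<notin> N" and EN: "E \<subseteq> insert z N \<times> N"
  using radial by (auto simp: radial_network_def)

lemma finE: "finite E"
  using finite_subset[OF EN] finN by auto

lemma par_edge: "j \<in> N \<Longrightarrow> (par j, j) \<in> E"
  unfolding par_def by (rule theI') (use radial in \<open>auto simp: radial_network_def\<close>)

lemma edgeD: assumes "(i, j) \<in> E" shows "j \<in> N" "i = par j" "i \<in> insert z N"
proof -
  show j: "j \<in> N" and "i \<in> insert z N" using assms EN by auto
  show "i = par j" using assms par_edge[OF j] radial j unfolding radial_network_def by blast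
qed

lemma par_in: "j \<in> N \<Longrightarrow> par j \<in> insert z N"
  using edgeD(3) par_edge by blast

lemma ball_edges: "(\<forall>(i, j)\<in>E. Q i j) \<longleftrightarrow> (\<forall>j\<in>N. Q (par j) j)"
  using par_edge edgeD by fastforce

lemma no_path_to_root: "(k, z) \<in> E\<^sup>* \<Longrightarrow> k = z"
  using edgeD(1) zN by (meson rtranclE)

text \<open>Parents are unique, so a cycle through a node also passes through its parent. Following
  the path from the root backwards, the cycle would reach the root, which no edge enters.\<close>

lemma acyclic_E: "acyclic E"
proof -
  have nocyc: "(j, j) \<notin> E\<^sup>+" if "(z, j) \<in> E\<^sup>+" for j
    using that
  proof (induction rule: trancl_induct)
    case (base j)
    show ?case
    proof
      assume "(j, j) \<in> E\<^sup>+"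
      then obtain k where k: "(j, k) \<in> E\<^sup>*" "(k, j) \<in> E" by (meson tranclD2)
      then have "k = z" using base edgeD(2) by metis
      then have "j = z" using k no_path_to_root by auto
      then show False using base edgeD(1) zN by auto
    qed
  next
    case (step i j)
    show ?case
    proof
      assume "(j, j) \<in> E\<^sup>+"
      then obtain k where k: "(j, k) \<in> E\<^sup>*" "(k, j) \<in> E" by (meson tranclD2)
      then have "k = i" using step edgeD(2) by metis
      then have "(i, i) \<in> E\<^sup>+" using k by (metis rtrancl_into_trancl2)
      then show False using step by auto
    qed
  qed
  show ?thesis
  proof (rule acyclicI, rule allI, rule notI)
    fix j assume c: "(j, j) \<in> E\<^sup>+"
    then obtain k where "(k, j) \<in> E" by (meson tranclD2)
    then have "(z, j) \<in> E\<^sup>+" using edgeD(1) radial by (auto simp: radial_network_def)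
    then show False using nocyc c by auto
  qed
qed

lemma self_in_subtree: "i \<in> subtree E i"
  by (simp add: subtree_def)

lemma subtree_subset: assumes "i \<in> N" shows "subtree E i \<subseteq> N"
proof
  fix k assume "k \<in> subtree E i"
  then have "(i, k) \<in> E\<^sup>*" by (simp add: subtree_def)
  then show "k \<in> N" using assms edgeD(1) by (cases rule: rtranclE) auto
qed

lemma finite_subtree: "i \<in> N \<Longrightarrow> finite (subtree E i)"
  using subtree_subset finN finite_subset by blast

lemma subtree_par: "j \<in> subtree E i \<longleftrightarrow> j = i \<or> (j \<in> N \<and> par j \<in> subtree E i)"
proof
  assume "j \<in> subtree E i"
  then have "(i, j) \<in> E\<^sup>*" by (simp add: subtree_def)
  then show "j = i \<or> (j \<in> N \<and> par j \<in> subtree E i)"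
    by (cases rule: rtranclE) (use edgeD in \<open>auto simp: subtree_def\<close>)
next
  assume "j = i \<or> (j \<in> N \<and> par j \<in> subtree E i)"
  then show "j \<in> subtree E i"
    using par_edge by (auto simp: subtree_def intro: rtrancl_into_rtrancl)
qed

lemma not_in_subtree_child: "j \<in> N \<Longrightarrow> par j \<notin> subtree E j"
  using par_edge[of j] acyclic_E unfolding acyclic_def subtree_def
  by (metis ImageE rtrancl_into_trancl1 singletonD)

lemma finite_anc: "finite (anc i)" and anc_subset: "anc i \<subseteq> N"
  using finN by (auto simp: anc_def)

lemma anc_root: "anc z = {}"
  using no_path_to_root zN by (auto simp: anc_def subtree_def)

lemma anc_par: "j \<in> N \<Longrightarrow> anc j = insert j (anc (par j))"
  by (auto simp: anc_def self_in_subtree subtree_par[of j])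

lemma not_in_anc_par: "j \<in> N \<Longrightarrow> j \<notin> anc (par j)"
  using not_in_subtree_child by (auto simp: anc_def)

text \<open>Unique parents make the ancestors of \<open>k\<close> a chain: walking up from
  \<open>k\<close>, one of \<open>a\<close> and \<open>b\<close> is met first and lies below the
  other.\<close>

lemma subtree_overlap:
  assumes "k \<in> subtree E a" "k \<in> subtree E b"
  shows "b \<in> subtree E a \<or> a \<in> subtree E b"
proof -
  have "(a, k) \<in> E\<^sup>*" "(b, k) \<in> E\<^sup>*" using assms by (auto simp: subtree_def)
  then have "(a, b) \<in> E\<^sup>* \<or> (b, a) \<in> E\<^sup>*"
  proof (induction arbitrary: b rule: rtrancl_induct)
    case base
    then show ?case by auto
  next
    case (step i j)
    show ?case
    proof (cases "b = j")
      case True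
      then show ?thesis using step.hyps by auto
    next
      case False
      then obtain i' where "(b, i') \<in> E\<^sup>*" "(i', j) \<in> E" using step.prems by (meson rtranclE)
      then show ?thesis using step edgeD(2) by metis
    qed
  qed
  then show ?thesis by (auto simp: subtree_def)
qed

section \<open>Flow and voltage recursions solved as sums over subtrees and paths\<close>

lemma sum_subtree:
  fixes b :: "'n \<Rightarrow> real"
  assumes j: "j \<in> N"
  shows "(\<Sum>k\<in>subtree E j. b k) = (\<Sum>k | (j, k) \<in> E. \<Sum>i\<in>subtree E k. b i) + b j"
proof -
  let ?C = "{k. (j, k) \<in> E}"
  have C: "?C \<subseteq> N" using edgeD(1) by auto
  have fC: "finite ?C" using C finN finite_subset by blast
  have eq: "subtree E j = insert j (\<Union>k\<in>?C. subtree E k)"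
  proof -
    have "i = j \<or> (\<exists>k. (j, k) \<in> E \<and> i \<in> subtree E k)" if "i \<in> subtree E j" for i
      using that by (auto simp: subtree_def elim: converse_rtranclE)
    moreover have "i \<in> subtree E j" if "(j, k) \<in> E" "i \<in> subtree E k" for i k
      using that by (auto simp: subtree_def)
    ultimately show ?thesis using self_in_subtree[of j] by (intro set_eqI) blast
  qed
  have nj: "j \<notin> (\<Union>k\<in>?C. subtree E k)"
    using not_in_subtree_child edgeD by fastforce
  have disj: "subtree E k \<inter> subtree E k' = {}" if "k \<in> ?C" "k' \<in> ?C" "k \<noteq> k'" for k k'
  proof (rule ccontr)
    assume "subtree E k \<inter> subtree E k' \<noteq> {}"
    then have "k' \<in> subtree E k \<or> k \<in> subtree E k'" using subtree_overlap by blast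
    \<comment> \<open>Both parents are \<open>j\<close>, so a child below another child would put
      \<open>j\<close> into the subtree of its own child.\<close>
    then have "par k' \<in> subtree E k \<or> par k \<in> subtree E k'"
      using that(3) subtree_par by metis
    then show False using that edgeD not_in_subtree_child by (metis mem_Collect_eq)
  qed
  have "(\<Sum>k\<in>(\<Union>k\<in>?C. subtree E k). b k) = (\<Sum>k\<in>?C. \<Sum>i\<in>subtree E k. b i)"
    using fC C finite_subtree disj by (intro sum.UNION_disjoint) auto
  moreover have "finite (\<Union>k\<in>?C. subtree E k)" using fC C finite_subtree by auto
  ultimately show ?thesis using eq nj by simp
qed

lemma flow_recursion_iff:
  fixes F b :: "'n \<Rightarrow> real"
  shows "(\<forall>j\<in>N. F j = (\<Sum>k | (j, k) \<in> E. F k) + b j) \<longleftrightarrow> (\<forall>j\<in>N. F j = (\<Sum>k\<in>subtree E j. b k))"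
    (is "?L \<longleftrightarrow> ?R")
proof
  assume L: ?L
  \<comment> \<open>The converse relation makes the induction run from the leaves upwards: the
    hypothesis speaks about the children.\<close>
  have "wf (E\<inverse>)" using finite_acyclic_wf_converse[OF finE acyclic_E] .
  then have "j \<in> N \<longrightarrow> F j = (\<Sum>k\<in>subtree E j. b k)" for j
  proof (induction j)
    case (less j)
    show ?case
    proof
      assume j: "j \<in> N"
      have "F j = (\<Sum>k | (j, k) \<in> E. F k) + b j" using L j by auto
      also have "(\<Sum>k | (j, k) \<in> E. F k) = (\<Sum>k | (j, k) \<in> E. \<Sum>i\<in>subtree E k. b i)"
        using less edgeD(1) by (intro sum.cong) auto
      finally show "F j = (\<Sum>k\<in>subtree E j. b k)" using sum_subtree[OF j] by simp
    qed
  qed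
  then show ?R by auto
next
  assume R: ?R
  show ?L
  proof
    fix j assume j: "j \<in> N"
    have "(\<Sum>k | (j, k) \<in> E. F k) = (\<Sum>k | (j, k) \<in> E. \<Sum>i\<in>subtree E k. b i)"
      using R edgeD(1) by (intro sum.cong) auto
    then show "F j = (\<Sum>k | (j, k) \<in> E. F k) + b j" using sum_subtree[OF j] R j by simp
  qed
qed

lemma volt_recursion_iff:
  fixes v D :: "'n \<Rightarrow> real"
  shows "v z = V \<and> (\<forall>j\<in>N. v j = v (par j) - D j) \<longleftrightarrow>
         (\<forall>i\<in>insert z N. v i = V - (\<Sum>k\<in>anc i. D k))" (is "?L \<longleftrightarrow> ?R")
proof -
  have step: "(\<Sum>k\<in>anc j. D k) = (\<Sum>k\<in>anc (par j). D k) + D j" if "j \<in> N" for j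
    using anc_par[OF that] not_in_anc_par[OF that] finite_anc by simp
  show ?thesis
  proof
    assume L: ?L
    \<comment> \<open>Voltages are determined in the opposite direction, from the root down.\<close>
    have "wf E" using finite_acyclic_wf[OF finE acyclic_E] .
    then have "i \<in> insert z N \<longrightarrow> v i = V - (\<Sum>k\<in>anc i. D k)" for i
    proof (induction i)
      case (less i)
      show ?case
      proof (cases "i = z")
        case True
        then show ?thesis using L anc_root by simp
      next
        case False
        show ?thesis
        proof
          assume "i \<in> insert z N"
          then have i: "i \<in> N" using False by auto
          then show "v i = V - (\<Sum>k\<in>anc i. D k)"
            using less[of "par i"] par_edge[OF i] par_in[OF i] L step[OF i]
            by (metis diff_diff_eq)
        qed
      qed
    qed
    then show ?R by auto
  next
    assume R: ?R
    have "v j = v (par j) - D j" if "j \<in> N" for j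
    proof -
      have "v (par j) = V - (\<Sum>k\<in>anc (par j). D k)" "v j = V - (\<Sum>k\<in>anc j. D k)"
        using R par_in[OF that] that by blast+
      then show ?thesis using step[OF that] by simp
    qed
    then show ?L using R anc_root by simp
  qed
qed

text \<open>One formula for both kinds of power: \<open>C\<close> selects the coordinate and
  \<open>w\<close> the impedance that turns current into loss. As the expression is jointly linear
  in \<open>d\<close> and \<open>y\<close>, it is later applied to increments and derivatives as
  well as to states.\<close>

definition flow ::
  "('n \<Rightarrow> 'n consumption) \<Rightarrow> ('n \<times> 'n \<Rightarrow> real) \<Rightarrow> ('n consumption \<Rightarrow> real) \<Rightarrow> ('n \<Rightarrow> real) \<Rightarrow> 'n \<Rightarrow> real" where
  "flow C w d y j = (\<Sum>k\<in>subtree E j. d (C k) + w (par k, k) * y k)"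

definition line_drop :: "('n consumption \<Rightarrow> real) \<Rightarrow> ('n \<Rightarrow> real) \<Rightarrow> 'n \<Rightarrow> real" where
  "line_drop d y k = 2 * r (par k, k) * flow Active r d y k + 2 * x (par k, k) * flow Reactive x d y k
                - ((r (par k, k))\<^sup>2 + (x (par k, k))\<^sup>2) * y k"

definition vdrop :: "('n consumption \<Rightarrow> real) \<Rightarrow> ('n \<Rightarrow> real) \<Rightarrow> 'n \<Rightarrow> real" where
  "vdrop d y i = (\<Sum>k\<in>anc i. line_drop d y k)"

text \<open>The affine constraints leave the currents free and determine all the rest, so NPF
  becomes a problem in the current vector alone.\<close>

lemma npf_affine_iff:
  "npf_affine z E r x V d s \<longleftrightarrow>
     (let y = (\<lambda>j. curr s (par j, j)) in
      (\<forall>j\<in>N. flowP s (par j, j) = flow Active r d y j \<and> flowQ s (par j, j) = flow Reactive x d y j) \<and>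
      (\<forall>i\<in>insert z N. volt s i = V - vdrop d y i))"
proof -
  define y where "y j = curr s (par j, j)" for j
  have ch: "(\<Sum>k | (j, k) \<in> E. F (j, k)) = (\<Sum>k | (j, k) \<in> E. F (par k, k))"
    for F :: "'n \<times> 'n \<Rightarrow> real" and j
    using edgeD(2) by (intro sum.cong) auto
  have P: "(\<forall>j\<in>N. flowP s (par j, j) = (\<Sum>k | (j, k) \<in> E. flowP s (j, k)) + d (Active j) + r (par j, j) * y j)
      \<longleftrightarrow> (\<forall>j\<in>N. flowP s (par j, j) = flow Active r d y j)"
    using flow_recursion_iff[of "\<lambda>j. flowP s (par j, j)" "\<lambda>j. d (Active j) + r (par j, j) * y j"]
    unfolding flow_def ch by (simp add: add.assoc)
  have Q: "(\<forall>j\<in>N. flowQ s (par j, j) = (\<Sum>k | (j, k) \<in> E. flowQ s (j, k)) + d (Reactive j) + x (par j, j) * y j)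
      \<longleftrightarrow> (\<forall>j\<in>N. flowQ s (par j, j) = flow Reactive x d y j)"
    using flow_recursion_iff[of "\<lambda>j. flowQ s (par j, j)" "\<lambda>j. d (Reactive j) + x (par j, j) * y j"]
    unfolding flow_def ch by (simp add: add.assoc)
  have V: "(volt s z = V \<and> (\<forall>j\<in>N. volt s j = volt s (par j) - 2 * r (par j, j) * flow Active r d y j
        - 2 * x (par j, j) * flow Reactive x d y j + ((r (par j, j))\<^sup>2 + (x (par j, j))\<^sup>2) * y j)) \<longleftrightarrow>
      (\<forall>i\<in>insert z N. volt s i = V - vdrop d y i)"
    using volt_recursion_iff[of "volt s" V "line_drop d y"] unfolding vdrop_def
    by (simp add: line_drop_def algebra_simps)
  have "npf_affine z E r x V d s \<longleftrightarrow> volt s z = V \<and>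
      (\<forall>j\<in>N. flowP s (par j, j) = flow Active r d y j) \<and> (\<forall>j\<in>N. flowQ s (par j, j) = flow Reactive x d y j) \<and>
      (\<forall>j\<in>N. volt s j = volt s (par j) - 2 * r (par j, j) * flowP s (par j, j)
        - 2 * x (par j, j) * flowQ s (par j, j) + ((r (par j, j))\<^sup>2 + (x (par j, j))\<^sup>2) * y j)"
    unfolding npf_affine_def ball_edges y_def[symmetric] P[symmetric] Q[symmetric] by blast
  also have "\<dots> \<longleftrightarrow>
      (\<forall>j\<in>N. flowP s (par j, j) = flow Active r d y j) \<and> (\<forall>j\<in>N. flowQ s (par j, j) = flow Reactive x d y j) \<and>
      (\<forall>i\<in>insert z N. volt s i = V - vdrop d y i)"
    unfolding V[symmetric] by (auto simp del: insert_iff)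
  finally show ?thesis unfolding Let_def y_def[symmetric] by blast
qed

lemma lpf_constraints_iff:
  "lpf_constraints z E r x V d s \<longleftrightarrow>
      (\<forall>j\<in>N. flowP s (par j, j) = flow Active r d (\<lambda>_. 0) j \<and>
             flowQ s (par j, j) = flow Reactive x d (\<lambda>_. 0) j \<and>
             curr s (par j, j) * volt s (par j) = (flowP s (par j, j))\<^sup>2 + (flowQ s (par j, j))\<^sup>2) \<and>
      (\<forall>i\<in>insert z N. volt s i = V - vdrop d (\<lambda>_. 0) i)"
proof -
  \<comment> \<open>Setting the currents to zero turns the affine part of NPF into the linear
    equations; the LPF current then comes back only through its own defining equation.\<close>
  have "lpf_constraints z E r x V d s \<longleftrightarrow>
     npf_affine z E r x V d (s\<lparr>curr := \<lambda>_. 0\<rparr>) \<and>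
     (\<forall>j\<in>N. curr s (par j, j) * volt s (par j) = (flowP s (par j, j))\<^sup>2 + (flowQ s (par j, j))\<^sup>2)"
    unfolding lpf_constraints_def npf_affine_def ball_edges by (auto simp: algebra_simps)
  then show ?thesis unfolding npf_affine_iff by (auto simp: Let_def)
qed


section \<open>Linearity, positivity and monotonicity of flows and voltage drops\<close>

lemma flow_lincomb:
  "flow C w (\<lambda>c. a * d c + b * e c) (\<lambda>k. a * y k + b * u k) j = a * flow C w d y j + b * flow C w e u j"
  unfolding flow_def by (simp add: sum_distrib_left algebra_simps flip: sum.distrib)

lemma vdrop_lincomb:
  "vdrop (\<lambda>c. a * d c + b * e c) (\<lambda>k. a * y k + b * u k) i = a * vdrop d y i + b * vdrop e u i"
  unfolding vdrop_def line_drop_def flow_lincomb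
  by (simp add: sum_distrib_left algebra_simps flip: sum.distrib)

lemma flow_diff: "flow C w d y j - flow C w e u j = flow C w (\<lambda>c. d c - e c) (\<lambda>k. y k - u k) j"
  using flow_lincomb[of C w 1 d "-1" e y u j] by simp

lemma vdrop_diff: "vdrop d y i - vdrop e u i = vdrop (\<lambda>c. d c - e c) (\<lambda>k. y k - u k) i"
  using vdrop_lincomb[of 1 d "-1" e y u i] by simp

lemma flow_scale: "flow C w (\<lambda>c. h * e c) (\<lambda>k. h * u k) j = h * flow C w e u j"
  using flow_lincomb[of C w h e 0 e u u j] by simp

lemma vdrop_scale: "vdrop (\<lambda>c. h * e c) (\<lambda>k. h * u k) i = h * vdrop e u i"
  using vdrop_lincomb[of h e 0 e u u i] by simp

text \<open>The first summand is the LPF flow, the second the accumulated losses. Estimates treat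
  the two separately, because only the second is small with the impedances for fixed
  currents.\<close>

lemma flow_split: "flow C w d y j = flow C w d (\<lambda>_. 0) j + flow C w (\<lambda>_. 0) y j"
  using flow_lincomb[of C w 1 d 1 "\<lambda>_. 0" "\<lambda>_. 0" y j] by simp

lemma vdrop_split: "vdrop d y i = vdrop d (\<lambda>_. 0) i + vdrop (\<lambda>_. 0) y i"
  using vdrop_lincomb[of 1 d 1 "\<lambda>_. 0" "\<lambda>_. 0" y i] by simp

lemma flow_consumption: "flow C w d (\<lambda>_. 0) j = (\<Sum>k\<in>subtree E j. d (C k))"
  by (simp add: flow_def)

lemma flow_losses: "flow C w (\<lambda>_. 0) y j = (\<Sum>k\<in>subtree E j. w (par k, k) * y k)"
  by (simp add: flow_def)

lemma nrpf_flow: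
  assumes "nrpf N E d" "j \<in> N"
  shows "0 \<le> flow Active w d (\<lambda>_. 0) j" "0 \<le> flow Reactive w d (\<lambda>_. 0) j"
  using assms by (auto simp: nrpf_def flow_consumption)

lemma losses_ge:
  assumes y: "\<forall>k\<in>N. 0 \<le> y k" and w: "\<And>e. e \<in> E \<Longrightarrow> 0 < w e" and j: "j \<in> N" and k: "k \<in> subtree E j"
  shows "w (par k, k) * y k \<le> flow C w (\<lambda>_. 0) y j"
  unfolding flow_losses
proof (rule member_le_sum[OF k _ finite_subtree[OF j]])
  fix i assume "i \<in> subtree E j - {k}"
  then have "i \<in> N" using subtree_subset[OF j] by auto
  then show "0 \<le> w (par i, i) * y i" using y w[OF par_edge] by (meson less_imp_le mult_nonneg_nonneg)
qed

lemma losses_nonneg: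
  assumes y: "\<forall>k\<in>N. 0 \<le> y k" and w: "\<And>e. e \<in> E \<Longrightarrow> 0 < w e" and j: "j \<in> N"
  shows "0 \<le> flow C w (\<lambda>_. 0) y j"
  using losses_ge[OF y w j self_in_subtree, where C = C] w[OF par_edge[OF j]] y j
  by (meson less_imp_le mult_nonneg_nonneg order_trans)

lemma flow_ge:
  assumes e: "nrpf N E e" and y: "\<forall>k\<in>N. 0 \<le> y k" and j: "j \<in> N"
  shows "flow Active r e (\<lambda>_. 0) j \<le> flow Active r e y j" "0 \<le> flow Active r e y j"
    "flow Reactive x e (\<lambda>_. 0) j \<le> flow Reactive x e y j" "0 \<le> flow Reactive x e y j"
  using flow_split[of Active r e y j] flow_split[of Reactive x e y j] nrpf_flow[OF e j]
    losses_nonneg[where w = r, OF y r_pos j] losses_nonneg[where w = x, OF y x_pos j] by (smt (verit))+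

text \<open>Each line enters its own losses into its flow, so the quadratic term of the voltage equation
  never outweighs the linear ones.\<close>

lemma line_drop_ge:
  assumes e: "nrpf N E e" and y: "\<forall>k\<in>N. 0 \<le> y k" and k: "k \<in> N"
  shows "line_drop e (\<lambda>_. 0) k + ((r (par k, k))\<^sup>2 + (x (par k, k))\<^sup>2) * y k \<le> line_drop e y k"
    "0 \<le> line_drop e (\<lambda>_. 0) k"
proof -
  have rx: "0 < r (par k, k)" "0 < x (par k, k)" using r_pos x_pos par_edge[OF k] by auto
  have A: "flow Active r e (\<lambda>_. 0) k + r (par k, k) * y k \<le> flow Active r e y k"
    using flow_split[of Active r e y k] losses_ge[where w = r, OF y r_pos k self_in_subtree, of Active] by simp
  have R: "flow Reactive x e (\<lambda>_. 0) k + x (par k, k) * y k \<le> flow Reactive x e y k"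
    using flow_split[of Reactive x e y k] losses_ge[where w = x, OF y x_pos k self_in_subtree, of Reactive] by simp
  \<comment> \<open>Doubled, these bounds provide the quadratic term twice; the voltage equation
    subtracts it once, and one copy is left as the surplus in the claim.\<close>
  have "r (par k, k) * (flow Active r e (\<lambda>_. 0) k + r (par k, k) * y k) \<le> r (par k, k) * flow Active r e y k"
    "x (par k, k) * (flow Reactive x e (\<lambda>_. 0) k + x (par k, k) * y k) \<le> x (par k, k) * flow Reactive x e y k"
    using A R rx by simp_all
  then show "line_drop e (\<lambda>_. 0) k + ((r (par k, k))\<^sup>2 + (x (par k, k))\<^sup>2) * y k \<le> line_drop e y k"
    by (simp add: line_drop_def algebra_simps power2_eq_square)
  show "0 \<le> line_drop e (\<lambda>_. 0) k"
    using rx nrpf_flow[OF e k] by (simp add: line_drop_def)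
qed

lemma line_drop_mono:
  assumes e: "nrpf N E e" and y: "\<forall>k\<in>N. 0 \<le> y k" and k: "k \<in> N"
  shows "line_drop e (\<lambda>_. 0) k \<le> line_drop e y k" "0 \<le> line_drop e y k"
proof -
  have "0 \<le> ((r (par k, k))\<^sup>2 + (x (par k, k))\<^sup>2) * y k" using y k by simp
  then show "line_drop e (\<lambda>_. 0) k \<le> line_drop e y k" "0 \<le> line_drop e y k" using line_drop_ge[OF assms] by linarith+
qed

lemma vdrop_ge:
  assumes e: "nrpf N E e" and y: "\<forall>k\<in>N. 0 \<le> y k"
  shows "vdrop e (\<lambda>_. 0) i \<le> vdrop e y i" "0 \<le> vdrop e (\<lambda>_. 0) i" "0 \<le> vdrop e y i"
  using line_drop_mono[OF e y] line_drop_ge(2)[OF e y] anc_subset[THEN subsetD]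
  by (auto simp: vdrop_def intro!: sum_mono sum_nonneg)

lemma nrpf_zero: "nrpf N E (\<lambda>_. 0)"
  by (simp add: nrpf_def)

lemma nrpf_nonneg: "(\<And>c. 0 \<le> e c) \<Longrightarrow> nrpf N E e"
  by (auto simp: nrpf_def intro: sum_nonneg)

text \<open>NRPF of the difference plays the role of an order on consumption vectors: monotonicity
  of a linear map is nonnegativity on increments, and only subtree sums of an increment enter the
  flows.\<close>

lemma flow_mono:
  assumes "nrpf N E (\<lambda>c. d' c - d c)" "\<forall>k\<in>N. y k \<le> y' k" "j \<in> N"
  shows "flow Active r d y j \<le> flow Active r d' y' j" "flow Reactive x d y j \<le> flow Reactive x d' y' j"
  using flow_ge(2,4)[OF assms(1), of "\<lambda>k. y' k - y k" j] assms(2,3) flow_diff[of _ _ d' y' j d y]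
  by (smt (verit, best))+

lemma vdrop_mono:
  assumes "nrpf N E (\<lambda>c. d' c - d c)" "\<forall>k\<in>N. y k \<le> y' k"
  shows "vdrop d y i \<le> vdrop d' y' i"
  using vdrop_ge(3)[OF assms(1), of "\<lambda>k. y' k - y k" i] assms(2) vdrop_diff[of d' y' i d y] by simp

lemma flow_cong: "(\<And>k. k \<in> N \<Longrightarrow> y k = u k) \<Longrightarrow> j \<in> N \<Longrightarrow> flow C w d y j = flow C w d u j"
  unfolding flow_def using subtree_subset[THEN subsetD] by (intro sum.cong) auto

lemma vdrop_cong: "(\<And>k. k \<in> N \<Longrightarrow> y k = u k) \<Longrightarrow> vdrop d y i = vdrop d u i"
  unfolding vdrop_def line_drop_def using anc_subset[THEN subsetD] flow_cong[of y u]
  by (intro sum.cong) auto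

end

subsection \<open>The current vector as a least fixed point\<close>

text \<open>On the box \<open>0 \<le> l \<le> L\<close> the smallness conditions keep all flows below \<open>K + 1\<close> and all
  voltages above \<open>V / 2\<close>; \<open>\<kappa>\<close> bounds the influence of a unit current on flows and voltages.\<close>

locale small_network = radial N z E r x
  for N :: "'n set" and z :: 'n and E and r x +
  fixes V M K L \<epsilon> \<kappa> :: real
  assumes V: "0 < V" and eps: "0 < \<epsilon>"
    and r_less: "\<And>e. e \<in> E \<Longrightarrow> r e < \<epsilon>" and x_less: "\<And>e. e \<in> E \<Longrightarrow> x e < \<epsilon>"
    and K_def: "K = real (card N) * \<bar>M\<bar>" and L_def: "L = 4 * (K + 1)\<^sup>2 / V"
    and kap_def: "\<kappa> = 6 * real (card N) * \<epsilon>"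
    and small1: "\<kappa> * (4 * (K + 1) + L) \<le> 1" and smallV: "\<kappa> * (4 * (K + 1) + L) \<le> V / 4"
begin

section \<open>Bounds for flows and voltages on the box of currents\<close>

lemma K0: "0 \<le> K" by (simp add: K_def)
lemma L0: "0 \<le> L" using V by (simp add: L_def)
lemma kap0: "0 \<le> \<kappa>" using eps by (simp add: kap_def)

lemma kap_small: "\<kappa> * 4 \<le> 1" "\<kappa> * L \<le> 1" "\<kappa> * K \<le> V / 4" "\<kappa> * L \<le> V / 4"
proof -
  have nn: "0 \<le> \<kappa> * K" "0 \<le> \<kappa> * L" using kap0 K0 L0 by auto
  have e: "\<kappa> * (4 * (K + 1) + L) = 4 * (\<kappa> * K) + 4 * \<kappa> + \<kappa> * L" by (simp add: algebra_simps)
  show "\<kappa> * 4 \<le> 1" "\<kappa> * L \<le> 1" "\<kappa> * K \<le> V / 4" "\<kappa> * L \<le> V / 4"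
    using e nn small1 smallV kap0 by linarith+
qed

lemma sum_le_card:
  fixes f :: "'n \<Rightarrow> real"
  assumes "A \<subseteq> N" "\<And>k. k \<in> A \<Longrightarrow> f k \<le> c" "0 \<le> c"
  shows "(\<Sum>k\<in>A. f k) \<le> real (card N) * c"
proof -
  have "(\<Sum>k\<in>A. f k) \<le> real (card A) * c" using assms(2) by (rule sum_bounded_above)
  also have "\<dots> \<le> real (card N) * c" using card_mono[OF finN assms(1)] assms(3) by (intro mult_right_mono) auto
  finally show ?thesis .
qed

lemma flow_losses_abs:
  assumes y: "\<forall>k\<in>N. \<bar>y k\<bar> \<le> c" and j: "j \<in> N" and w: "\<And>e. e \<in> E \<Longrightarrow> 0 < w e \<and> w e < \<epsilon>"
  shows "\<bar>flow C w (\<lambda>_. 0) y j\<bar> \<le> real (card N) * (\<epsilon> * c)"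
proof -
  have c0: "0 \<le> c" using y j by fastforce
  have "\<bar>flow C w (\<lambda>_. 0) y j\<bar> \<le> (\<Sum>k\<in>subtree E j. \<bar>w (par k, k) * y k\<bar>)"
    unfolding flow_losses by (rule sum_abs)
  also have "\<dots> \<le> real (card N) * (\<epsilon> * c)"
  proof (rule sum_le_card)
    show "subtree E j \<subseteq> N" using subtree_subset[OF j] .
    show "0 \<le> \<epsilon> * c" using eps c0 by simp
    fix k assume "k \<in> subtree E j"
    then have k: "k \<in> N" using subtree_subset[OF j] by auto
    show "\<bar>w (par k, k) * y k\<bar> \<le> \<epsilon> * c"
      unfolding abs_mult using w[OF par_edge[OF k]] y k eps by (intro mult_mono) auto
  qed
  finally show ?thesis .
qed

lemma flow_losses_bound:
  assumes y: "\<forall>k\<in>N. \<bar>y k\<bar> \<le> c" and j: "j \<in> N"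
  shows "\<bar>flow C r (\<lambda>_. 0) y j\<bar> \<le> \<kappa> * c" "\<bar>flow C x (\<lambda>_. 0) y j\<bar> \<le> \<kappa> * c"
proof -
  have "0 \<le> c" using y j by fastforce
  then have "0 \<le> real (card N) * (\<epsilon> * c)" using eps by simp
  then have "real (card N) * (\<epsilon> * c) \<le> 6 * (real (card N) * (\<epsilon> * c))" by linarith
  also have "\<dots> = \<kappa> * c" by (simp add: kap_def)
  finally have "real (card N) * (\<epsilon> * c) \<le> \<kappa> * c" .
  then show "\<bar>flow C r (\<lambda>_. 0) y j\<bar> \<le> \<kappa> * c" "\<bar>flow C x (\<lambda>_. 0) y j\<bar> \<le> \<kappa> * c"
    using flow_losses_abs[OF y j, of r C] flow_losses_abs[OF y j, of x C] r_pos x_pos r_less x_less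
    by fastforce+
qed

lemma vdrop_losses_bound:
  assumes y: "\<forall>k\<in>N. \<bar>y k\<bar> \<le> c" and c0: "0 \<le> c"
  shows "\<bar>vdrop (\<lambda>_. 0) y i\<bar> \<le> \<kappa> * c"
proof -
  let ?n = "real (card N)"
  have bd: "\<bar>line_drop (\<lambda>_. 0) y k\<bar> \<le> 6 * \<epsilon> * (?n * (\<epsilon> * c))" if k: "k \<in> anc i" for k
  proof -
    have kN: "k \<in> N" using k anc_subset by auto
    \<comment> \<open>The quadratic term of the drop has no sum over a subtree; a factor of at least
      1 brings it to the common bound.\<close>
    then have n1: "1 \<le> ?n" using finN by (metis Suc_leI card_gt_0_iff empty_iff of_nat_1 of_nat_mono One_nat_def)
    have rx: "0 < r (par k, k)" "0 < x (par k, k)" "r (par k, k) < \<epsilon>" "x (par k, k) < \<epsilon>"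
      using r_pos x_pos r_less x_less par_edge[OF kN] by auto
    have F: "\<bar>flow Active r (\<lambda>_. 0) y k\<bar> \<le> ?n * (\<epsilon> * c)" "\<bar>flow Reactive x (\<lambda>_. 0) y k\<bar> \<le> ?n * (\<epsilon> * c)"
      using r_pos x_pos r_less x_less by (auto intro!: flow_losses_abs[OF y kN])
    have 1: "\<bar>r (par k, k) * flow Active r (\<lambda>_. 0) y k\<bar> \<le> \<epsilon> * (?n * (\<epsilon> * c))"
      unfolding abs_mult using rx F by (intro mult_mono) auto
    have 2: "\<bar>x (par k, k) * flow Reactive x (\<lambda>_. 0) y k\<bar> \<le> \<epsilon> * (?n * (\<epsilon> * c))"
      unfolding abs_mult using rx F by (intro mult_mono) auto
    have w: "\<bar>w * (w * y k)\<bar> \<le> \<epsilon> * (?n * (\<epsilon> * c))" if "0 < w" "w < \<epsilon>" for w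
    proof -
      have "\<bar>w * (w * y k)\<bar> \<le> \<epsilon> * (\<epsilon> * c)"
        unfolding abs_mult using that y kN eps by (intro mult_mono) auto
      also have "\<dots> \<le> \<epsilon> * (?n * (\<epsilon> * c))"
        using eps n1 c0 mult_right_mono[of 1 ?n "\<epsilon> * c"] by (intro mult_left_mono) auto
      finally show ?thesis .
    qed
    \<comment> \<open>The coefficients 2, 2, 1 and 1 of this expansion add up to the 6 in
      \<open>\<kappa>\<close>.\<close>
    have "line_drop (\<lambda>_. 0) y k = 2 * (r (par k, k) * flow Active r (\<lambda>_. 0) y k)
        + 2 * (x (par k, k) * flow Reactive x (\<lambda>_. 0) y k)
        - r (par k, k) * (r (par k, k) * y k) - x (par k, k) * (x (par k, k) * y k)"
      by (simp add: line_drop_def power2_eq_square algebra_simps)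
    then show ?thesis using 1 2 w[OF rx(1,3)] w[OF rx(2,4)] by linarith
  qed
  have "\<bar>vdrop (\<lambda>_. 0) y i\<bar> \<le> (\<Sum>k\<in>anc i. \<bar>line_drop (\<lambda>_. 0) y k\<bar>)"
    unfolding vdrop_def by (rule sum_abs)
  also have "\<dots> \<le> ?n * (6 * \<epsilon> * (?n * (\<epsilon> * c)))"
    using bd anc_subset eps c0 by (intro sum_le_card) auto
  \<comment> \<open>A drop caused by losses is quadratic in the impedances. One factor is given up,
    bounded by 1, so that drops and flows share the same bound.\<close>
  also have "\<dots> = (\<kappa> * c) * (?n * \<epsilon>)" by (simp add: kap_def)
  also have "\<dots> \<le> (\<kappa> * c) * 1"
    using kap0 c0 kap_small(1) eps by (intro mult_left_mono) (auto simp: kap_def)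
  finally show ?thesis by simp
qed

lemma admissibleD:
  assumes d: "d \<in> admissible N E M"
  shows "nrpf N E d"
    and "j \<in> N \<Longrightarrow> flow Active w d (\<lambda>_. 0) j \<le> K" "j \<in> N \<Longrightarrow> flow Reactive w d (\<lambda>_. 0) j \<le> K"
proof -
  show "nrpf N E d" using d by (simp add: admissible_def)
  have "d c \<le> \<bar>M\<bar>" if "node_of c \<in> N" for c using d that by (force simp: admissible_def)
  then show "j \<in> N \<Longrightarrow> flow Active w d (\<lambda>_. 0) j \<le> K" "j \<in> N \<Longrightarrow> flow Reactive w d (\<lambda>_. 0) j \<le> K"
    unfolding flow_consumption K_def using subtree_subset[THEN subsetD] by (auto intro!: sum_le_card)
qed

lemma vdrop_consumption_bound:
  assumes d: "d \<in> admissible N E M"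
  shows "vdrop d (\<lambda>_. 0) i \<le> V / 4"
proof -
  have "line_drop d (\<lambda>_. 0) k \<le> 4 * \<epsilon> * K" if "k \<in> anc i" for k
  proof -
    have kN: "k \<in> N" using that anc_subset by auto
    have rx: "0 < r (par k, k)" "0 < x (par k, k)" "r (par k, k) < \<epsilon>" "x (par k, k) < \<epsilon>"
      using r_pos x_pos r_less x_less par_edge[OF kN] by auto
    have "r (par k, k) * flow Active r d (\<lambda>_. 0) k \<le> \<epsilon> * K"
      "x (par k, k) * flow Reactive x d (\<lambda>_. 0) k \<le> \<epsilon> * K"
      using rx K0 admissibleD(2,3)[OF d kN] nrpf_flow[OF admissibleD(1)[OF d] kN] by (auto intro!: mult_mono)
    then show ?thesis by (simp add: line_drop_def)
  qed
  then have "vdrop d (\<lambda>_. 0) i \<le> real (card N) * (4 * \<epsilon> * K)"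
    unfolding vdrop_def using anc_subset eps K0 by (intro sum_le_card) auto
  also have "\<dots> \<le> \<kappa> * K" using eps K0 by (simp add: kap_def mult.assoc)
  finally show ?thesis using kap_small by simp
qed

text \<open>Losses add at most \<open>\<kappa> * L \<le> 1\<close> to a flow that consumption keeps
  below \<open>K\<close>. Consumption and losses each take at most \<open>V / 4\<close> off the
  voltage.\<close>

lemma box_bounds:
  assumes d: "d \<in> admissible N E M" and y: "\<forall>k\<in>N. 0 \<le> y k \<and> y k \<le> L"
  shows "j \<in> N \<Longrightarrow> 0 \<le> flow Active r d y j \<and> flow Active r d y j \<le> K + 1"
    "j \<in> N \<Longrightarrow> 0 \<le> flow Reactive x d y j \<and> flow Reactive x d y j \<le> K + 1"
    "V / 2 \<le> V - vdrop d y i" "V - vdrop d y i \<le> V"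
proof -
  have yL: "\<forall>k\<in>N. \<bar>y k\<bar> \<le> L" using y by auto
  note n = admissibleD(1)[OF d]
  show "0 \<le> flow Active r d y j \<and> flow Active r d y j \<le> K + 1" if j: "j \<in> N"
    using flow_ge[OF n _ j, of y] y flow_losses_bound(1)[OF yL j, of Active] flow_split[of Active r d y j] admissibleD(2)[OF d j, of r]
      kap_small(2) by auto
  show "0 \<le> flow Reactive x d y j \<and> flow Reactive x d y j \<le> K + 1" if j: "j \<in> N"
    using flow_ge[OF n _ j, of y] y flow_losses_bound(2)[OF yL j, of Reactive] flow_split[of Reactive x d y j] admissibleD(3)[OF d j, of x]
      kap_small(2) by auto
  show "V / 2 \<le> V - vdrop d y i"
    using vdrop_losses_bound[OF yL L0, of i] vdrop_split[of d y i] vdrop_consumption_bound[OF d, of i] kap_small(4)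
    by (auto simp: field_simps)
  show "V - vdrop d y i \<le> V" using vdrop_ge(3)[OF n, of y i] y by auto
qed

section \<open>The least current vector and its monotonicity\<close>

definition power_balance :: "('n consumption \<Rightarrow> real) \<Rightarrow> ('n \<Rightarrow> real) \<Rightarrow> bool" where
  "power_balance d l \<longleftrightarrow> (\<forall>j\<in>N. 0 \<le> l j \<and> l j \<le> L \<and>
     l j * (V - vdrop d l (par j)) = (flow Active r d l j)\<^sup>2 + (flow Reactive x d l j)\<^sup>2)"

text \<open>The relaxed problem in terms of currents. In contrast to \<open>power_balance\<close>
  there is no upper bound, since the competitors in the minimisation may have currents outside the
  box.\<close>

definition feasible :: "('n consumption \<Rightarrow> real) \<Rightarrow> ('n \<Rightarrow> real) \<Rightarrow> bool" where
  "feasible d y \<longleftrightarrow> (\<forall>j\<in>N. 0 \<le> y j \<and>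
     (flow Active r d y j)\<^sup>2 + (flow Reactive x d y j)\<^sup>2 \<le> y j * (V - vdrop d y (par j)))"

lemma least_current_exists:
  assumes d: "d \<in> admissible N E M"
  shows "\<exists>l. power_balance d l \<and> (\<forall>y. feasible d y \<longrightarrow> (\<forall>j\<in>N. l j \<le> y j))"
proof -
  define G where "G y j = ((flow Active r d y j)\<^sup>2 + (flow Reactive x d y j)\<^sup>2) / (V - vdrop d y (par j))" for y j
  note n = admissibleD(1)[OF d]
  have den: "0 < V - vdrop d y i" if "\<forall>k\<in>N. 0 \<le> y k \<and> y k \<le> L" for y i
    using box_bounds(3)[OF d that, of i] V by linarith
  have mono: "\<forall>j\<in>N. G u j \<le> G v j" if uv: "\<forall>j\<in>N. 0 \<le> u j \<and> u j \<le> v j \<and> v j \<le> L" for u v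
  proof
    fix j assume j: "j \<in> N"
    have ub: "\<forall>k\<in>N. 0 \<le> u k \<and> u k \<le> L" and vb: "\<forall>k\<in>N. 0 \<le> v k \<and> v k \<le> L" and le: "\<forall>k\<in>N. u k \<le> v k"
      using uv by fastforce+
    show "G u j \<le> G v j"
      unfolding G_def
      using flow_mono[of d d u v j] vdrop_mono[of d d u v "par j"] le j box_bounds(1,2)[OF d ub j] den[OF vb, of "par j"] nrpf_zero
      by (intro frac_le add_mono power_mono) auto
  qed
  have box: "\<forall>j\<in>N. 0 \<le> G u j \<and> G u j \<le> L" if u: "\<forall>j\<in>N. 0 \<le> u j \<and> u j \<le> L" for u
  proof
    fix j assume j: "j \<in> N"
    have "(flow Active r d u j)\<^sup>2 + (flow Reactive x d u j)\<^sup>2 \<le> (K + 1)\<^sup>2 + (K + 1)\<^sup>2"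
      using box_bounds(1,2)[OF d u j] by (intro add_mono power_mono) auto
    then have "G u j \<le> ((K + 1)\<^sup>2 + (K + 1)\<^sup>2) / (V / 2)"
      unfolding G_def using box_bounds(3)[OF d u, of "par j"] V by (intro frac_le) auto
    \<comment> \<open>\<open>L\<close> is the largest sum of squared flows divided by the smallest
      voltage on the box.\<close>
    also have "\<dots> = L" by (simp add: L_def)
    finally show "0 \<le> G u j \<and> G u j \<le> L" using den[OF u, of "par j"] by (simp add: G_def)
  qed
  obtain l where l: "\<forall>j\<in>N. 0 \<le> l j \<and> l j \<le> L \<and> G l j = l j"
    and least: "\<And>y. (\<forall>j\<in>N. 0 \<le> y j \<and> y j \<le> L \<and> G y j \<le> y j) \<Longrightarrow> \<forall>j\<in>N. l j \<le> y j"
    using least_fixpoint_box[of N L G, OF mono box L0] by blast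
  have lb: "\<forall>j\<in>N. 0 \<le> l j \<and> l j \<le> L" using l by auto
  have "power_balance d l"
    unfolding power_balance_def
  proof (intro ballI conjI)
    fix j assume j: "j \<in> N"
    show "l j * (V - vdrop d l (par j)) = (flow Active r d l j)\<^sup>2 + (flow Reactive x d l j)\<^sup>2"
      using l j den[OF lb, of "par j"] unfolding G_def by (metis nonzero_eq_divide_eq less_irrefl)
  qed (use lb in auto)
  moreover have "\<forall>j\<in>N. l j \<le> y j" if y: "feasible d y" for y
  proof -
    \<comment> \<open>A feasible vector may leave the box, so it is cut off at \<open>L\<close>. The
      truncation is a pre-fixed point: its image is at most \<open>L\<close> because the box is
      invariant, and at most \<open>y\<close> by monotonicity. The comparison with \<open>y\<close>
      multiplies by voltages and never divides by the voltage belonging to \<open>y\<close>, which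
      need not be positive.\<close>
    define u where "u k = min (y k) L" for k
    have y0: "\<forall>k\<in>N. 0 \<le> y k" using y by (simp add: feasible_def)
    have ub: "\<forall>k\<in>N. 0 \<le> u k \<and> u k \<le> L" using y0 L0 by (auto simp: u_def)
    have uy: "\<forall>k\<in>N. u k \<le> y k" by (auto simp: u_def)
    have "G u j \<le> y j" if j: "j \<in> N" for j
    proof -
      have "(flow Active r d u j)\<^sup>2 + (flow Reactive x d u j)\<^sup>2 \<le> (flow Active r d y j)\<^sup>2 + (flow Reactive x d y j)\<^sup>2"
        using flow_mono[of d d u y j] uy j box_bounds(1,2)[OF d ub j] nrpf_zero by (intro add_mono power_mono) auto
      also have "\<dots> \<le> y j * (V - vdrop d y (par j))" using y j by (simp add: feasible_def)
      also have "\<dots> \<le> y j * (V - vdrop d u (par j))"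
        using vdrop_mono[of d d u y "par j"] uy y0 j nrpf_zero by (intro mult_left_mono) auto
      finally show ?thesis unfolding G_def using den[OF ub, of "par j"] by (simp add: divide_le_eq)
    qed
    then have "\<forall>j\<in>N. 0 \<le> u j \<and> u j \<le> L \<and> G u j \<le> u j" using ub box[OF ub] unfolding u_def by (metis min.boundedI)
    from least[OF this] show ?thesis using uy by force
  qed
  ultimately show ?thesis by blast
qed

definition ell :: "('n consumption \<Rightarrow> real) \<Rightarrow> 'n \<Rightarrow> real" where
  "ell d = (SOME l. power_balance d l \<and> (\<forall>y. feasible d y \<longrightarrow> (\<forall>j\<in>N. l j \<le> y j)))"

lemma ell_balance: "d \<in> admissible N E M \<Longrightarrow> power_balance d (ell d)"
  and ell_least: "d \<in> admissible N E M \<Longrightarrow> feasible d y \<Longrightarrow> j \<in> N \<Longrightarrow> ell d j \<le> y j"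
  using someI_ex[OF least_current_exists[of d]] unfolding ell_def by blast+

lemma ell_box: "d \<in> admissible N E M \<Longrightarrow> \<forall>j\<in>N. 0 \<le> ell d j \<and> ell d j \<le> L"
  and ell_eq: "d \<in> admissible N E M \<Longrightarrow> j \<in> N \<Longrightarrow>
    ell d j * (V - vdrop d (ell d) (par j)) = (flow Active r d (ell d) j)\<^sup>2 + (flow Reactive x d (ell d) j)\<^sup>2"
  using ell_balance[of d] by (auto simp: power_balance_def)

text \<open>With the currents of the larger load kept, the smaller load has smaller flows and larger
  voltages. They are therefore feasible for the smaller load, and leastness finishes the
  argument.\<close>

lemma ell_mono:
  assumes d: "d \<in> admissible N E M" and d': "d' \<in> admissible N E M" and le: "nrpf N E (\<lambda>c. d' c - d c)"
  shows "\<forall>j\<in>N. ell d j \<le> ell d' j"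
proof -
  note b = ell_box[OF d']
  have "feasible d (ell d')"
    unfolding feasible_def
  proof (intro ballI conjI)
    fix j assume j: "j \<in> N"
    show "0 \<le> ell d' j" using b j by auto
    have "(flow Active r d (ell d') j)\<^sup>2 + (flow Reactive x d (ell d') j)\<^sup>2
        \<le> (flow Active r d' (ell d') j)\<^sup>2 + (flow Reactive x d' (ell d') j)\<^sup>2"
      using flow_mono[OF le, of "ell d'" "ell d'" j] j box_bounds(1,2)[OF d b j] by (intro add_mono power_mono) auto
    also have "\<dots> = ell d' j * (V - vdrop d' (ell d') (par j))" using ell_eq[OF d' j] by simp
    also have "\<dots> \<le> ell d' j * (V - vdrop d (ell d') (par j))"
      using vdrop_mono[OF le, of "ell d'" "ell d'"] b j by (intro mult_left_mono) auto
    finally show "(flow Active r d (ell d') j)\<^sup>2 + (flow Reactive x d (ell d') j)\<^sup>2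
        \<le> ell d' j * (V - vdrop d (ell d') (par j))" .
  qed
  then show ?thesis using ell_least[OF d] by blast
qed

lemma feasible_of_relaxed:
  assumes "npf_relaxed N z E r x V d s"
  shows "feasible d (\<lambda>j. curr s (par j, j))"
proof -
  let ?y = "\<lambda>j. curr s (par j, j)"
  have v: "volt s (par j) = V - vdrop d ?y (par j)" if "j \<in> N" for j
    using assms par_in[OF that] unfolding npf_relaxed_def npf_affine_iff Let_def by blast
  have f: "flowP s (par j, j) = flow Active r d ?y j" "flowQ s (par j, j) = flow Reactive x d ?y j"
    and c: "(flowP s (par j, j))\<^sup>2 + (flowQ s (par j, j))\<^sup>2 \<le> ?y j * volt s (par j)" "0 \<le> ?y j"
    if "j \<in> N" for j
    using assms that par_edge unfolding npf_relaxed_def npf_affine_iff ball_edges Let_def by blast+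
  show ?thesis
    unfolding feasible_def using c by (simp flip: f v)
qed

section \<open>The least current vector as the unique NPF solution\<close>

definition npf_model :: "('n consumption \<Rightarrow> real) \<Rightarrow> 'n flow_state" where
  "npf_model d = \<lparr>flowP = (\<lambda>(i, j). flow Active r d (ell d) j), flowQ = (\<lambda>(i, j). flow Reactive x d (ell d) j),
     curr = (\<lambda>(i, j). ell d j), volt = (\<lambda>i. V - vdrop d (ell d) i)\<rparr>"

lemma npf_model_affine: "npf_affine z E r x V d (npf_model d)"
  unfolding npf_affine_iff by (simp add: npf_model_def Let_def)

lemma npf_model_relaxed:
  assumes d: "d \<in> admissible N E M"
  shows "npf_relaxed N z E r x V d (npf_model d)"
  unfolding npf_relaxed_def
proof (intro conjI npf_model_affine)
  show "\<forall>(i, j)\<in>E. (flowP (npf_model d) (i, j))\<^sup>2 + (flowQ (npf_model d) (i, j))\<^sup>2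
      \<le> curr (npf_model d) (i, j) * volt (npf_model d) i"
    unfolding ball_edges using ell_eq[OF d] by (simp add: npf_model_def)
  show "\<forall>e\<in>E. 0 \<le> curr (npf_model d) e"
    using ell_box[OF d] edgeD by (auto simp: npf_model_def)
  show "\<forall>i\<in>insert z N. 0 \<le> volt (npf_model d) i"
  proof
    fix i
    show "0 \<le> volt (npf_model d) i"
      using box_bounds(3)[OF d ell_box[OF d], of i] V by (simp add: npf_model_def)
  qed
qed

text \<open>Because \<open>V \<le> vnom\<close>, voltages of the model are at most nominal, and
  their deviation grows with the currents; so the voltage term favours the model. The gap in the
  resistive losses is kept in the statement since it yields uniqueness, also for
  \<open>W = 0\<close>.\<close>

lemma npf_model_cost:
  assumes d: "d \<in> admissible N E M" and s: "npf_relaxed N z E r x V d s" and "V \<le> vnom" "0 \<le> W"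
  shows "npf_cost N E r vnom W (npf_model d) + (\<Sum>e\<in>E. r e * (curr s e - curr (npf_model d) e))
    \<le> npf_cost N E r vnom W s"
proof -
  define y where "y j = curr s (par j, j)" for j
  have fy: "feasible d y" using feasible_of_relaxed[OF s] by (simp add: y_def[abs_def])
  have le: "\<forall>j\<in>N. ell d j \<le> y j" using ell_least[OF d fy] by blast
  have vs: "volt s i = V - vdrop d y i" if "i \<in> N" for i
    using s that unfolding npf_relaxed_def npf_affine_iff Let_def y_def[abs_def] by auto
  have "Max ((\<lambda>i. \<bar>vnom - volt (npf_model d) i\<bar>) ` N) \<le> Max ((\<lambda>i. \<bar>vnom - volt s i\<bar>) ` N)"
  proof (cases "N = {}")
    case False
    have "\<bar>vnom - volt (npf_model d) i\<bar> \<le> Max ((\<lambda>i. \<bar>vnom - volt s i\<bar>) ` N)" if i: "i \<in> N" for i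
    proof -
      have "\<bar>vnom - volt (npf_model d) i\<bar> = vnom - (V - vdrop d (ell d) i)"
        using box_bounds(4)[OF d ell_box[OF d], of i] assms(3) by (simp add: npf_model_def)
      also have "\<dots> \<le> vnom - (V - vdrop d y i)"
        using vdrop_mono[of d d "ell d" y i] le nrpf_zero by simp
      also have "\<dots> \<le> \<bar>vnom - volt s i\<bar>" using vs[OF i] by simp
      also have "\<dots> \<le> Max ((\<lambda>i. \<bar>vnom - volt s i\<bar>) ` N)" using finN i by (intro Max_ge) auto
      finally show ?thesis .
    qed
    then show ?thesis using finN False by (intro Max.boundedI) auto
  qed simp
  then have "W * Max ((\<lambda>i. \<bar>vnom - volt (npf_model d) i\<bar>) ` N) \<le> W * Max ((\<lambda>i. \<bar>vnom - volt s i\<bar>) ` N)"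
    using assms(4) by (rule mult_left_mono)
  then show ?thesis
    unfolding npf_cost_def by (simp add: right_diff_distrib sum_subtractf)
qed

lemma curr_ge_model:
  assumes d: "d \<in> admissible N E M" and s: "npf_relaxed N z E r x V d s" and e: "e \<in> E"
  shows "curr (npf_model d) e \<le> curr s e"
proof -
  obtain i j where ij: "e = (i, j)" "j \<in> N" "i = par j" using e edgeD by (cases e) auto
  then show ?thesis using ell_least[OF d feasible_of_relaxed[OF s], of j] by (simp add: npf_model_def)
qed

lemma npf_solution_unique:
  assumes d: "d \<in> admissible N E M" and "vnom - dv = V" "0 \<le> dv" "0 \<le> W"
    and s: "npf_solution N z E r x vnom dv W d s"
  shows "\<And>i j. (i, j) \<in> E \<Longrightarrow> flowP s (i, j) = flow Active r d (ell d) j \<and>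
           flowQ s (i, j) = flow Reactive x d (ell d) j \<and> curr s (i, j) = ell d j"
    and "\<And>i. i \<in> insert z N \<Longrightarrow> volt s i = V - vdrop d (ell d) i"
proof -
  have rel: "npf_relaxed N z E r x V d s" using s assms(2) by (simp add: npf_solution_def)
  have "npf_cost N E r vnom W s \<le> npf_cost N E r vnom W (npf_model d)"
    using s npf_model_relaxed[OF d] assms(2) by (simp add: npf_solution_def)
  \<comment> \<open>Every summand is nonnegative by leastness and every resistance is positive, so a
    nonpositive sum forces equal currents on all lines.\<close>
  then have "(\<Sum>e\<in>E. r e * (curr s e - curr (npf_model d) e)) \<le> 0"
    using npf_model_cost[OF d rel _ assms(4), of vnom] assms(2,3) by linarith
  moreover have nn: "\<forall>e\<in>E. 0 \<le> r e * (curr s e - curr (npf_model d) e)"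
    using curr_ge_model[OF d rel] r_pos by (simp add: less_imp_le)
  ultimately have "(\<Sum>e\<in>E. r e * (curr s e - curr (npf_model d) e)) = 0"
    by (meson antisym sum_nonneg)
  then have "\<forall>e\<in>E. r e * (curr s e - curr (npf_model d) e) = 0"
    using nn finE sum_nonneg_eq_0_iff[of E "\<lambda>e. r e * (curr s e - curr (npf_model d) e)"] by simp
  then have c: "curr s e = curr (npf_model d) e" if "e \<in> E" for e using r_pos that by fastforce
  then have cj: "curr s (par j, j) = ell d j" if "j \<in> N" for j
    using par_edge[OF that] by (simp add: npf_model_def)
  have aff: "npf_affine z E r x V d s" using rel by (simp add: npf_relaxed_def)
  show "flowP s (i, j) = flow Active r d (ell d) j \<and>
        flowQ s (i, j) = flow Reactive x d (ell d) j \<and> curr s (i, j) = ell d j" if ij: "(i, j) \<in> E" for i j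
    using aff edgeD[OF ij] cj flow_cong[of "\<lambda>j. curr s (par j, j)" "ell d" j]
    unfolding npf_affine_iff Let_def by auto
  show "volt s i = V - vdrop d (ell d) i" if "i \<in> insert z N" for i
    using aff that cj vdrop_cong[of "\<lambda>j. curr s (par j, j)" "ell d"]
    unfolding npf_affine_iff Let_def by auto
qed

lemma npf_state_solution:
  assumes d: "d \<in> admissible N E M" and "vnom - dv = V" "0 \<le> dv" "0 \<le> W"
  shows "npf_solution N z E r x vnom dv W d (npf_state N z E r x vnom dv W d)"
  unfolding npf_state_def
proof (rule someI)
  show "npf_solution N z E r x vnom dv W d (npf_model d)"
    unfolding npf_solution_def assms(2)
  proof (intro conjI allI impI npf_model_relaxed[OF d])
    fix s assume s: "npf_relaxed N z E r x V d s"
    have "0 \<le> (\<Sum>e\<in>E. r e * (curr s e - curr (npf_model d) e))"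
      using curr_ge_model[OF d s] r_pos by (intro sum_nonneg) (simp add: less_imp_le)
    then show "npf_cost N E r vnom W (npf_model d) \<le> npf_cost N E r vnom W s"
      using npf_model_cost[OF d s _ assms(4), of vnom] assms(2,3) by linarith
  qed
qed

lemma npf_solution_constraints:
  assumes d: "d \<in> admissible N E M" and "vnom - dv = V" "0 \<le> dv" "0 \<le> W"
    and s: "npf_solution N z E r x vnom dv W d s"
  shows "npf_constraints z E r x V d s"
proof -
  have "npf_affine z E r x V d s" using s assms(2) by (simp add: npf_solution_def npf_relaxed_def)
  then show ?thesis
    using npf_solution_unique[OF assms] ell_eq[OF d] par_edge par_in
    unfolding npf_constraints_def ball_edges by simp
qed

section \<open>The LPF state\<close>

definition lpf_current :: "('n consumption \<Rightarrow> real) \<Rightarrow> 'n \<Rightarrow> real" where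
  "lpf_current d j = ((flow Active r d (\<lambda>_. 0) j)\<^sup>2 + (flow Reactive x d (\<lambda>_. 0) j)\<^sup>2)
     / (V - vdrop d (\<lambda>_. 0) (par j))"

text \<open>Flows and voltages of LPF are those for zero currents, which belong to the box;
  \<open>box_bounds\<close> thus covers LPF too.\<close>

lemma zero_box: "\<forall>k\<in>N. 0 \<le> (0::real) \<and> 0 \<le> L"
  using L0 by simp

lemma lpf_state_constraints:
  assumes d: "d \<in> admissible N E M"
  shows "lpf_constraints z E r x V d (SOME s. lpf_constraints z E r x V d s)"
proof (rule someI)
  have "V - vdrop d (\<lambda>_. 0) i \<noteq> 0" for i
    using box_bounds(3)[OF d zero_box, of i] V by linarith
  then show "lpf_constraints z E r x V d
    \<lparr>flowP = (\<lambda>(i, j). flow Active r d (\<lambda>_. 0) j), flowQ = (\<lambda>(i, j). flow Reactive x d (\<lambda>_. 0) j),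
     curr = (\<lambda>(i, j). lpf_current d j), volt = (\<lambda>i. V - vdrop d (\<lambda>_. 0) i)\<rparr>"
    unfolding lpf_constraints_iff by (simp add: lpf_current_def)
qed

lemma lpf_unique:
  assumes d: "d \<in> admissible N E M" and s: "lpf_constraints z E r x V d s"
  shows "\<And>i j. (i, j) \<in> E \<Longrightarrow> flowP s (i, j) = flow Active r d (\<lambda>_. 0) j \<and>
           flowQ s (i, j) = flow Reactive x d (\<lambda>_. 0) j \<and> curr s (i, j) = lpf_current d j"
    and "\<And>i. i \<in> insert z N \<Longrightarrow> volt s i = V - vdrop d (\<lambda>_. 0) i"
proof -
  have nz: "V - vdrop d (\<lambda>_. 0) i \<noteq> 0" for i
    using box_bounds(3)[OF d zero_box, of i] V by linarith
  show "volt s i = V - vdrop d (\<lambda>_. 0) i" if "i \<in> insert z N" for i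
    using s that unfolding lpf_constraints_iff by auto
  show "flowP s (i, j) = flow Active r d (\<lambda>_. 0) j \<and>
      flowQ s (i, j) = flow Reactive x d (\<lambda>_. 0) j \<and> curr s (i, j) = lpf_current d j" if ij: "(i, j) \<in> E" for i j
    using s edgeD[OF ij] nz[of "par j"] unfolding lpf_constraints_iff lpf_current_def
    by (auto simp: eq_divide_eq)
qed

subsection \<open>Differentiability and monotonicity\<close>

definition unit_at :: "'n consumption \<Rightarrow> 'n consumption \<Rightarrow> real" where
  "unit_at c = (\<lambda>c'. if c' = c then 1 else 0)"

lemma nrpf_unit: "0 \<le> h \<Longrightarrow> nrpf N E (\<lambda>c'. h * unit_at c c')"
  by (rule nrpf_nonneg) (simp add: unit_at_def)

lemma nrpf_unit1: "nrpf N E (unit_at c)"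
  by (rule nrpf_nonneg) (simp add: unit_at_def)

lemma upd_diff: "(\<lambda>c'. (d(c := t)) c' - (d(c := u)) c') = (\<lambda>c'. (t - u) * unit_at c c')"
  by (auto simp: unit_at_def)

text \<open>In the maximum norm the homogeneous right-hand side is at most \<open>V / 4\<close>
  times that of \<open>y\<close>, while the left-hand side has a factor of at least
  \<open>V / 2\<close>: a contraction by one half. The coefficients may reach
  \<open>2 * (K + 1)\<close> because difference quotients of squares carry the sum of two
  flows.\<close>

lemma linear_system_bound:
  assumes sys: "\<And>j. j \<in> N \<Longrightarrow> \<bar>p j\<bar> \<le> 2 * (K + 1) \<and> \<bar>q j\<bar> \<le> 2 * (K + 1) \<and> \<bar>l j\<bar> \<le> L \<and> V / 2 \<le> \<nu> j \<and> \<bar>e j\<bar> \<le> b \<and>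
      \<nu> j * y j = p j * flow Active r (\<lambda>_. 0) y j + q j * flow Reactive x (\<lambda>_. 0) y j
                  + l j * vdrop (\<lambda>_. 0) y (par j) + e j"
    and j: "j \<in> N"
  shows "\<bar>y j\<bar> \<le> 4 * b / V"
proof -
  have "\<bar>y j\<bar> \<le> 2 * (2 * b / V)"
  proof (rule half_contraction_bound[OF finN _ j])
    fix c j assume j: "j \<in> N" and c: "\<forall>k\<in>N. \<bar>y k\<bar> \<le> c"
    have c0: "0 \<le> c" using c j by fastforce
    have kc: "0 \<le> \<kappa> * c" using kap0 c0 by simp
    have 1: "\<bar>p j * flow Active r (\<lambda>_. 0) y j\<bar> \<le> 2 * (K + 1) * (\<kappa> * c)"
      "\<bar>q j * flow Reactive x (\<lambda>_. 0) y j\<bar> \<le> 2 * (K + 1) * (\<kappa> * c)"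
      "\<bar>l j * vdrop (\<lambda>_. 0) y (par j)\<bar> \<le> L * (\<kappa> * c)"
      unfolding abs_mult using sys[OF j] flow_losses_bound[OF c j] vdrop_losses_bound[OF c c0] K0 L0
      by (auto intro!: mult_mono)
    have "V / 2 * \<bar>y j\<bar> \<le> \<bar>\<nu> j * y j\<bar>"
      unfolding abs_mult using sys[OF j] V by (intro mult_right_mono) auto
    also have "\<nu> j * y j = p j * flow Active r (\<lambda>_. 0) y j + q j * flow Reactive x (\<lambda>_. 0) y j
                  + l j * vdrop (\<lambda>_. 0) y (par j) + e j" using sys[OF j] by blast
    also have "\<bar>\<dots>\<bar> \<le> \<bar>p j * flow Active r (\<lambda>_. 0) y j + q j * flow Reactive x (\<lambda>_. 0) y j
                  + l j * vdrop (\<lambda>_. 0) y (par j)\<bar> + \<bar>e j\<bar>" by (rule abs_triangle_ineq)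
    also have "\<dots> \<le> 2 * (K + 1) * (\<kappa> * c) + 2 * (K + 1) * (\<kappa> * c) + L * (\<kappa> * c) + b"
      using sys[OF j] by (intro add_mono abs_add3_le[OF 1]) blast
    finally have nu: "V / 2 * \<bar>y j\<bar> \<le> 2 * (K + 1) * (\<kappa> * c) + 2 * (K + 1) * (\<kappa> * c) + L * (\<kappa> * c) + b" .
    have e: "2 * (K + 1) * (\<kappa> * c) + 2 * (K + 1) * (\<kappa> * c) + L * (\<kappa> * c) = (\<kappa> * (4 * (K + 1) + L)) * c"
      by (simp add: algebra_simps)
    have "(\<kappa> * (4 * (K + 1) + L)) * c \<le> V / 4 * c" using smallV c0 by (rule mult_right_mono)
    then have "V / 2 * \<bar>y j\<bar> \<le> V / 4 * c + b" using nu e by linarith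
    moreover have "(c / 2 + 2 * b / V) * (V / 2) = V / 4 * c + b" using V by (simp add: field_simps)
    ultimately have "\<bar>y j\<bar> * (V / 2) \<le> (c / 2 + 2 * b / V) * (V / 2)" by (simp add: mult.commute)
    then show "\<bar>y j\<bar> \<le> c / 2 + 2 * b / V" using V by (meson half_gt_zero mult_le_cancel_right_pos)
  qed
  then show ?thesis by simp
qed

text \<open>The equation is the power balance differentiated in direction \<open>e\<close>. Its
  right-hand side is monotone in \<open>m\<close> and nonnegative for nonnegative \<open>m\<close>,
  so the order-theoretic fixed point gives existence together with the sign.\<close>

lemma sensitivity_exists:
  assumes d: "d \<in> admissible N E M" and e: "nrpf N E e"
  shows "\<exists>m. \<forall>j\<in>N. 0 \<le> m j \<and> (V - vdrop d (ell d) (par j)) * m j =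
    2 * flow Active r d (ell d) j * flow Active r e m j + 2 * flow Reactive x d (ell d) j * flow Reactive x e m j
    + ell d j * vdrop e m (par j)"
proof -
  define R where "R y j = 2 * flow Active r d (ell d) j * flow Active r e y j
    + 2 * flow Reactive x d (ell d) j * flow Reactive x e y j + ell d j * vdrop e y (par j)" for y j
  define \<nu> where "\<nu> j = V - vdrop d (ell d) (par j)" for j
  define b where "b = (\<Sum>j\<in>N. \<bar>R (\<lambda>_. 0) j\<bar>)"
  \<comment> \<open>The radius solves \<open>b + V / 4 * c = V / 2 * c\<close>, which is the
    condition for the box to be mapped into itself.\<close>
  define c where "c = 4 * b / V"
  note lb = ell_box[OF d]
  have b0: "0 \<le> b" by (simp add: b_def sum_nonneg)
  have c0: "0 \<le> c" using b0 V by (simp add: c_def)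
  have nu: "V / 2 \<le> \<nu> j" for j unfolding \<nu>_def using box_bounds(3)[OF d lb] .
  have nu0: "0 < \<nu> j" for j using nu[of j] V by linarith
  have Rb: "\<bar>R (\<lambda>_. 0) j\<bar> \<le> b" if "j \<in> N" for j
    unfolding b_def using finN that by (intro member_le_sum) auto
  have coef: "0 \<le> flow Active r d (ell d) j" "flow Active r d (ell d) j \<le> K + 1"
     "0 \<le> flow Reactive x d (ell d) j" "flow Reactive x d (ell d) j \<le> K + 1"
     "0 \<le> ell d j" "ell d j \<le> L" if "j \<in> N" for j
    using box_bounds(1,2)[OF d lb that] lb that by auto
  have mono: "\<forall>j\<in>N. R u j / \<nu> j \<le> R v j / \<nu> j" if uv: "\<forall>j\<in>N. 0 \<le> u j \<and> u j \<le> v j \<and> v j \<le> c" for u v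
    using flow_mono[of e e u v] vdrop_mono[of e e u v] uv coef nu0 nrpf_zero unfolding R_def
    by (auto intro!: divide_right_mono add_mono mult_left_mono simp: less_imp_le)
  have box: "\<forall>j\<in>N. 0 \<le> R u j / \<nu> j \<and> R u j / \<nu> j \<le> c" if u: "\<forall>j\<in>N. 0 \<le> u j \<and> u j \<le> c" for u
  proof
    fix j assume j: "j \<in> N"
    have u0: "\<forall>k\<in>N. 0 \<le> u k" and uc: "\<forall>k\<in>N. \<bar>u k\<bar> \<le> c" using u by auto
    have split: "R u j = R (\<lambda>_. 0) j + (2 * flow Active r d (ell d) j * flow Active r (\<lambda>_. 0) u j
      + 2 * flow Reactive x d (ell d) j * flow Reactive x (\<lambda>_. 0) u j + ell d j * vdrop (\<lambda>_. 0) u (par j))"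
      unfolding R_def
      by (simp add: flow_split[of _ _ e u] vdrop_split[of e u] algebra_simps)
    have 1: "2 * flow Active r d (ell d) j * flow Active r (\<lambda>_. 0) u j \<le> 2 * (K + 1) * (\<kappa> * c)"
      "2 * flow Reactive x d (ell d) j * flow Reactive x (\<lambda>_. 0) u j \<le> 2 * (K + 1) * (\<kappa> * c)"
      "ell d j * vdrop (\<lambda>_. 0) u (par j) \<le> L * (\<kappa> * c)"
      using coef[OF j] abs_le_D1[OF flow_losses_bound(1)[OF uc j]] abs_le_D1[OF flow_losses_bound(2)[OF uc j]]
        abs_le_D1[OF vdrop_losses_bound[OF uc c0]] K0 L0
        flow_ge(2,4)[OF nrpf_zero u0 j] vdrop_ge(3)[OF nrpf_zero u0]
      by (auto intro!: mult_mono)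
    have e: "2 * (K + 1) * (\<kappa> * c) + 2 * (K + 1) * (\<kappa> * c) + L * (\<kappa> * c) = (\<kappa> * (4 * (K + 1) + L)) * c"
      by (simp add: algebra_simps)
    have "(\<kappa> * (4 * (K + 1) + L)) * c \<le> V / 4 * c" using smallV c0 by (rule mult_right_mono)
    then have "R u j \<le> b + V / 4 * c" using split 1 e Rb[OF j] by linarith
    also have "\<dots> = V / 2 * c" using V by (simp add: c_def)
    also have "\<dots> \<le> \<nu> j * c" using nu c0 by (rule mult_right_mono)
    finally have "R u j / \<nu> j \<le> c" using nu0[of j] by (simp add: divide_le_eq mult.commute)
    moreover have "0 \<le> R u j"
      unfolding R_def using coef[OF j] flow_ge(2,4)[OF assms(2) u0 j] vdrop_ge(3)[OF assms(2) u0] by simp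
    ultimately show "0 \<le> R u j / \<nu> j \<and> R u j / \<nu> j \<le> c" using nu0[of j] by simp
  qed
  obtain m where m: "\<forall>j\<in>N. 0 \<le> m j \<and> m j \<le> c \<and> R m j / \<nu> j = m j"
    using least_fixpoint_box[of N c "\<lambda>y j. R y j / \<nu> j", OF mono box c0] by blast
  have "\<nu> j * m j = R m j" if "j \<in> N" for j
    using m that nu0[of j] by (metis nonzero_mult_div_cancel_left times_divide_eq_right less_irrefl)
  then show ?thesis using m unfolding R_def \<nu>_def by (intro exI[of _ m]) auto
qed

text \<open>The difference quotients of the currents solve a linear system whose coefficients tend to those
  of the system for \<open>m\<close>; since both are contractions, the quotients converge to \<open>m\<close>.\<close>

lemma ell_derivative:
  assumes d: "d \<in> admissible N E M"
    and m: "\<And>j. j \<in> N \<Longrightarrow> (V - vdrop d (ell d) (par j)) * m j =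
      2 * flow Active r d (ell d) j * flow Active r (unit_at c) m j
      + 2 * flow Reactive x d (ell d) j * flow Reactive x (unit_at c) m j
      + ell d j * vdrop (unit_at c) m (par j)"
    and T: "\<And>t. t \<in> T \<Longrightarrow> d(c := t) \<in> admissible N E M"
    and j: "j \<in> N"
  shows "((\<lambda>t. ell (d(c := t)) j) has_real_derivative m j) (at (d c) within T)"
proof -
  let ?e = "unit_at c" and ?l = "ell d" and ?lt = "\<lambda>t. ell (d(c := t))"
  define u where "u t k = (?lt t k - ?l k) / (t - d c)" for t k
  let ?P = "flow Active r" and ?Q = "flow Reactive x" and ?z = "\<lambda>_. 0 :: real"
  note lb = ell_box[OF d]
  have tb: "\<forall>j\<in>N. 0 \<le> ?lt t j \<and> ?lt t j \<le> L" if "t \<in> T" for t using ell_box[OF T[OF that]] .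
  have scale: "(\<lambda>k. ?lt t k - ?l k) = (\<lambda>k. (t - d c) * u t k)" if "t \<noteq> d c" for t
    using that by (auto simp: u_def)
  have dd: "(\<lambda>c'. (d(c := t)) c' - d c') = (\<lambda>c'. (t - d c) * ?e c')" for t
    by (auto simp: unit_at_def)
  have dP: "?P (d(c := t)) (?lt t) k - ?P d ?l k = (t - d c) * ?P ?e (u t) k"
    and dQ: "?Q (d(c := t)) (?lt t) k - ?Q d ?l k = (t - d c) * ?Q ?e (u t) k"
    and dV: "vdrop (d(c := t)) (?lt t) i - vdrop d ?l i = (t - d c) * vdrop ?e (u t) i"
    if "t \<noteq> d c" for t k i
    unfolding flow_diff vdrop_diff dd scale[OF that] flow_scale vdrop_scale by simp_all
  \<comment> \<open>The system for the quotients is exact. Differences of squares contribute the sum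
    of old and new flow; the difference of the products is split so that the new voltage goes with
    the quotient and the old current with the voltage drop.\<close>
  have sys: "(V - vdrop (d(c := t)) (?lt t) (par k)) * u t k =
      (?P (d(c := t)) (?lt t) k + ?P d ?l k) * ?P ?e (u t) k
      + (?Q (d(c := t)) (?lt t) k + ?Q d ?l k) * ?Q ?e (u t) k + ?l k * vdrop ?e (u t) (par k)"
    if t: "t \<in> T" "t \<noteq> d c" and k: "k \<in> N" for t k
  proof -
    let ?h = "t - d c"
    let ?P' = "?P (d(c := t)) (?lt t) k" and ?Q' = "?Q (d(c := t)) (?lt t) k" and ?v' = "vdrop (d(c := t)) (?lt t) (par k)"
    have lt: "?h * u t k = ?lt t k - ?l k" using t by (simp add: u_def)
    have 1: "?lt t k * (V - ?v') = ?P'\<^sup>2 + ?Q'\<^sup>2" using ell_eq[OF T[OF t(1)] k] .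
    have 2: "?l k * (V - vdrop d ?l (par k)) = (?P d ?l k)\<^sup>2 + (?Q d ?l k)\<^sup>2" using ell_eq[OF d k] .
    have "?h * ((V - ?v') * u t k) = (?lt t k - ?l k) * (V - ?v')"
      unfolding lt[symmetric] by (simp only: mult_ac)
    also have "\<dots> = (?P'\<^sup>2 - (?P d ?l k)\<^sup>2) + (?Q'\<^sup>2 - (?Q d ?l k)\<^sup>2) + ?l k * (?v' - vdrop d ?l (par k))"
      using 1 2 by (simp add: algebra_simps)
    also have "\<dots> = (?P' + ?P d ?l k) * (?P' - ?P d ?l k) + (?Q' + ?Q d ?l k) * (?Q' - ?Q d ?l k)
        + ?l k * (?v' - vdrop d ?l (par k))"
      by (simp add: power2_eq_square algebra_simps)
    also have "\<dots> = ?h * ((?P' + ?P d ?l k) * ?P ?e (u t) k + (?Q' + ?Q d ?l k) * ?Q ?e (u t) k + ?l k * vdrop ?e (u t) (par k))"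
      unfolding dP[OF t(2)] dQ[OF t(2)] dV[OF t(2)] by (simp add: algebra_simps)
    finally show ?thesis using t(2) by simp
  qed
  have coef: "\<bar>?P (d(c := t)) (?lt t) k + ?P d ?l k\<bar> \<le> 2 * (K + 1)" "\<bar>?Q (d(c := t)) (?lt t) k + ?Q d ?l k\<bar> \<le> 2 * (K + 1)"
     "\<bar>?l k\<bar> \<le> L" "V / 2 \<le> V - vdrop (d(c := t)) (?lt t) (par k)" if "t \<in> T" "k \<in> N" for t k
    using box_bounds(1,2)[OF d lb that(2)] box_bounds(1,2,3)[OF T[OF that(1)] tb[OF that(1)]] that lb by fastforce+
  \<comment> \<open>A bound, uniform in \<open>t\<close>, for the terms driven by the unit change of
    consumption itself. Taken as the inhomogeneity of the system it makes \<open>C\<close> a common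
    bound of all quotients.\<close>
  define a where "a k = 2 * (K + 1) * \<bar>?P ?e ?z k\<bar> + 2 * (K + 1) * \<bar>?Q ?e ?z k\<bar> + L * \<bar>vdrop ?e ?z (par k)\<bar>" for k
  define b where "b = (\<Sum>k\<in>N. a k)"
  define C where "C = 4 * b / V"
  have a0: "0 \<le> a k" for k using K0 L0 by (simp add: a_def)
  have ab: "a k \<le> b" if "k \<in> N" for k unfolding b_def using finN that a0 by (intro member_le_sum) auto
  have C0: "0 \<le> C" using sum_nonneg[of N a] a0 V by (simp add: C_def b_def)
  have ub: "\<bar>u t k\<bar> \<le> C" if t: "t \<in> T" "t \<noteq> d c" and k: "k \<in> N" for t k
    unfolding C_def
  proof (rule linear_system_bound[OF _ k])
    fix i assume i: "i \<in> N"
    let ?p = "?P (d(c := t)) (?lt t) i + ?P d ?l i" and ?q = "?Q (d(c := t)) (?lt t) i + ?Q d ?l i"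
    let ?r = "?p * ?P ?e ?z i + ?q * ?Q ?e ?z i + ?l i * vdrop ?e ?z (par i)"
    have "\<bar>?p * ?P ?e ?z i\<bar> \<le> 2 * (K + 1) * \<bar>?P ?e ?z i\<bar>" "\<bar>?q * ?Q ?e ?z i\<bar> \<le> 2 * (K + 1) * \<bar>?Q ?e ?z i\<bar>"
      "\<bar>?l i * vdrop ?e ?z (par i)\<bar> \<le> L * \<bar>vdrop ?e ?z (par i)\<bar>"
      unfolding abs_mult using coef[OF t(1) i] by (auto intro!: mult_right_mono)
    then have "\<bar>?r\<bar> \<le> b" by (rule order_trans[OF abs_add3_le ab[OF i, unfolded a_def]])
    moreover have "(V - vdrop (d(c := t)) (?lt t) (par i)) * u t i =
        ?p * ?P ?z (u t) i + ?q * ?Q ?z (u t) i + ?l i * vdrop ?z (u t) (par i) + ?r"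
      unfolding sys[OF t i] by (subst (1 2) flow_split, subst vdrop_split) (simp add: algebra_simps)
    ultimately show "\<bar>?p\<bar> \<le> 2 * (K + 1) \<and> \<bar>?q\<bar> \<le> 2 * (K + 1) \<and> \<bar>?l i\<bar> \<le> L \<and>
        V / 2 \<le> V - vdrop (d(c := t)) (?lt t) (par i) \<and> \<bar>?r\<bar> \<le> b \<and>
        (V - vdrop (d(c := t)) (?lt t) (par i)) * u t i =
        ?p * ?P ?z (u t) i + ?q * ?Q ?z (u t) i + ?l i * vdrop ?z (u t) (par i) + ?r"
      using coef[OF t(1) i] by blast
  qed
  \<comment> \<open>The coefficients for \<open>u t\<close> differ from those for \<open>m\<close>
    by \<open>t - d c\<close> times the responses of flows and voltages to the change. As
    \<open>C\<close> bounds the quotients, \<open>g\<close> bounds these responses multiplied by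
    their factors from \<open>m\<close>, and the error is of order \<open>t - d c\<close>.\<close>
  define g where "g k = (\<bar>?P ?e ?z k\<bar> + \<kappa> * C) * \<bar>?P ?e m k\<bar> + (\<bar>?Q ?e ?z k\<bar> + \<kappa> * C) * \<bar>?Q ?e m k\<bar>
    + (\<bar>vdrop ?e ?z (par k)\<bar> + \<kappa> * C) * \<bar>m k\<bar>" for k
  define G where "G = (\<Sum>k\<in>N. g k)"
  have g0: "0 \<le> g k" for k using kap0 C0 by (simp add: g_def)
  have gG: "g k \<le> G" if "k \<in> N" for k unfolding G_def using finN that g0 by (intro member_le_sum) auto
  have conv: "\<bar>u t k - m k\<bar> \<le> 4 * (\<bar>t - d c\<bar> * G) / V" if t: "t \<in> T" "t \<noteq> d c" and k: "k \<in> N" for t k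
  proof (rule linear_system_bound[OF _ k])
    fix i assume i: "i \<in> N"
    let ?h = "t - d c"
    let ?p = "?P (d(c := t)) (?lt t) i + ?P d ?l i" and ?q = "?Q (d(c := t)) (?lt t) i + ?Q d ?l i"
    let ?v = "V - vdrop (d(c := t)) (?lt t) (par i)" and ?y = "\<lambda>k. u t k - m k"
    let ?r = "?h * (?P ?e (u t) i * ?P ?e m i + ?Q ?e (u t) i * ?Q ?e m i + vdrop ?e (u t) (par i) * m i)"
    have ubt: "\<forall>k\<in>N. \<bar>u t k\<bar> \<le> C" using ub[OF t] by auto
    have "\<bar>?P ?e (u t) i\<bar> \<le> \<bar>?P ?e ?z i\<bar> + \<kappa> * C" "\<bar>?Q ?e (u t) i\<bar> \<le> \<bar>?Q ?e ?z i\<bar> + \<kappa> * C"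
      "\<bar>vdrop ?e (u t) (par i)\<bar> \<le> \<bar>vdrop ?e ?z (par i)\<bar> + \<kappa> * C"
      using flow_losses_bound(1)[OF ubt i, of Active] flow_losses_bound(2)[OF ubt i, of Reactive]
        vdrop_losses_bound[OF ubt C0, of "par i"] flow_split[of Active r ?e "u t" i]
        flow_split[of Reactive x ?e "u t" i] vdrop_split[of ?e "u t" "par i"] by linarith+
    then have "\<bar>?P ?e (u t) i * ?P ?e m i\<bar> \<le> (\<bar>?P ?e ?z i\<bar> + \<kappa> * C) * \<bar>?P ?e m i\<bar>"
      "\<bar>?Q ?e (u t) i * ?Q ?e m i\<bar> \<le> (\<bar>?Q ?e ?z i\<bar> + \<kappa> * C) * \<bar>?Q ?e m i\<bar>"
      "\<bar>vdrop ?e (u t) (par i) * m i\<bar> \<le> (\<bar>vdrop ?e ?z (par i)\<bar> + \<kappa> * C) * \<bar>m i\<bar>"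
      unfolding abs_mult by (auto intro!: mult_right_mono)
    then have "\<bar>?P ?e (u t) i * ?P ?e m i + ?Q ?e (u t) i * ?Q ?e m i + vdrop ?e (u t) (par i) * m i\<bar> \<le> G"
      by (rule order_trans[OF abs_add3_le gG[OF i, unfolded g_def]])
    then have r: "\<bar>?r\<bar> \<le> \<bar>?h\<bar> * G" unfolding abs_mult by (rule mult_left_mono) simp
    have yP: "?P ?z ?y i = ?P ?e (u t) i - ?P ?e m i" "?Q ?z ?y i = ?Q ?e (u t) i - ?Q ?e m i"
      "vdrop ?z ?y (par i) = vdrop ?e (u t) (par i) - vdrop ?e m (par i)"
      unfolding flow_diff vdrop_diff by simp_all
    have P': "?P (d(c := t)) (?lt t) i = ?P d ?l i + ?h * ?P ?e (u t) i"
      "?Q (d(c := t)) (?lt t) i = ?Q d ?l i + ?h * ?Q ?e (u t) i"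
      "vdrop (d(c := t)) (?lt t) (par i) = vdrop d ?l (par i) + ?h * vdrop ?e (u t) (par i)"
      using dP[OF t(2), of i] dQ[OF t(2), of i] dV[OF t(2), of "par i"] by simp_all
    have "?v * ?y i = ?v * u t i - (V - vdrop d ?l (par i)) * m i + ?h * vdrop ?e (u t) (par i) * m i"
      unfolding P' by (simp add: algebra_simps)
    also have "\<dots> = ?p * ?P ?z ?y i + ?q * ?Q ?z ?y i + ?l i * vdrop ?z ?y (par i) + ?r"
      unfolding sys[OF t i] m[OF i] yP unfolding P' by (simp add: algebra_simps)
    finally show "\<bar>?p\<bar> \<le> 2 * (K + 1) \<and> \<bar>?q\<bar> \<le> 2 * (K + 1) \<and> \<bar>?l i\<bar> \<le> L \<and> V / 2 \<le> ?v \<and> \<bar>?r\<bar> \<le> \<bar>?h\<bar> * G \<and>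
        ?v * ?y i = ?p * ?P ?z ?y i + ?q * ?Q ?z ?y i + ?l i * vdrop ?z ?y (par i) + ?r"
      using coef[OF t(1) i] r by blast
  qed
  have "((\<lambda>t. u t j - m j) \<longlongrightarrow> 0) (at (d c) within T)"
  proof (rule tendsto_0_le)
    have "norm (u t j - m j) \<le> norm (4 * (\<bar>t - d c\<bar> * G) / V) * 1" if "t \<in> T" "t \<noteq> d c" for t
      unfolding real_norm_def using conv[OF that j] by linarith
    then show "\<forall>\<^sub>F t in at (d c) within T. norm (u t j - m j) \<le> norm (4 * (\<bar>t - d c\<bar> * G) / V) * 1"
      by (auto simp: eventually_at_filter)
    have "((\<lambda>t. 4 * (\<bar>t - d c\<bar> * G) / V) \<longlongrightarrow> 4 * (\<bar>d c - d c\<bar> * G) / V) (at (d c) within T)"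
      using V by (intro tendsto_intros) auto
    then show "((\<lambda>t. 4 * (\<bar>t - d c\<bar> * G) / V) \<longlongrightarrow> 0) (at (d c) within T)" by simp
  qed
  then have "((\<lambda>t. u t j) \<longlongrightarrow> m j) (at (d c) within T)" by (simp add: LIM_zero_iff)
  then show ?thesis unfolding has_field_derivative_iff u_def by simp
qed

section \<open>Monotonicity in the consumption and comparison of the two currents\<close>

lemma npf_mono:
  assumes d: "d \<in> admissible N E M" and d': "d' \<in> admissible N E M" and le: "nrpf N E (\<lambda>c. d' c - d c)"
  shows "j \<in> N \<Longrightarrow> flow Active r d (ell d) j \<le> flow Active r d' (ell d') j"
    "j \<in> N \<Longrightarrow> flow Reactive x d (ell d) j \<le> flow Reactive x d' (ell d') j"
    "vdrop d (ell d) i \<le> vdrop d' (ell d') i"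
  using flow_mono[OF le ell_mono[OF assms]] vdrop_mono[OF le ell_mono[OF assms]] by auto

lemma lpf_mono:
  assumes d: "d \<in> admissible N E M" and d': "d' \<in> admissible N E M" and le: "nrpf N E (\<lambda>c. d' c - d c)"
    and j: "j \<in> N"
  shows "lpf_current d j \<le> lpf_current d' j"
  unfolding lpf_current_def
  using flow_mono[OF le _ j, of "\<lambda>_. 0" "\<lambda>_. 0"] vdrop_mono[OF le, of "\<lambda>_. 0" "\<lambda>_. 0"] box_bounds(1,2)[OF d zero_box j]
    box_bounds(3)[OF d' zero_box, of "par j"] V
  by (intro frac_le add_mono power_mono) auto

lemma ell_as_quotient:
  assumes d: "d \<in> admissible N E M" and j: "j \<in> N"
  shows "ell d j = ((flow Active r d (ell d) j)\<^sup>2 + (flow Reactive x d (ell d) j)\<^sup>2) / (V - vdrop d (ell d) (par j))"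
  using ell_eq[OF d j] box_bounds(3)[OF d ell_box[OF d], of "par j"] V by (simp add: eq_divide_eq)

text \<open>Both currents are quotients of the same form; NPF has the larger flows above and the
  smaller voltage below.\<close>

lemma lpf_current_le_ell:
  assumes d: "d \<in> admissible N E M" and j: "j \<in> N"
  shows "lpf_current d j \<le> ell d j" "0 \<le> lpf_current d j"
proof -
  have l0: "\<forall>k\<in>N. 0 \<le> ell d k" using ell_box[OF d] by auto
  note n = admissibleD(1)[OF d]
  show "lpf_current d j \<le> ell d j"
    unfolding lpf_current_def ell_as_quotient[OF assms]
    using flow_ge[OF n l0 j] vdrop_ge[OF n l0, of "par j"] box_bounds(1,2)[OF d zero_box j]
      box_bounds(3)[OF d ell_box[OF d], of "par j"] V
    by (intro frac_le add_mono power_mono) auto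
  show "0 \<le> lpf_current d j"
    unfolding lpf_current_def using box_bounds(3)[OF d zero_box, of "par j"] V by simp
qed

section \<open>Strict monotonicity within a feeder\<close>

lemma feederE:
  assumes "k \<in> feeder z E i"
  obtains a where "(z, a) \<in> E" "a \<in> N" "par a = z" "i \<in> subtree E a" "k \<in> subtree E a"
  using assms edgeD by (auto simp: feeder_def)

text \<open>Two children of the root with a common descendant coincide, for otherwise the root would
  lie below one of them.\<close>

lemma feeder_eq:
  assumes a: "(z, a) \<in> E" and i: "i \<in> subtree E a"
  shows "feeder z E i = subtree E a"
proof -
  have "b = a" if b: "(z, b) \<in> E" and ib: "i \<in> subtree E b" for b
  proof (rule ccontr)
    assume "b \<noteq> a"
    moreover have "b \<in> subtree E a \<or> a \<in> subtree E b" using subtree_overlap[OF i ib] .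
    ultimately have "par b \<in> subtree E a \<or> par a \<in> subtree E b"
      using subtree_par[of b a] subtree_par[of a b] by blast
    then have "z \<in> subtree E a \<or> z \<in> subtree E b"
      unfolding edgeD(2)[OF a, symmetric] edgeD(2)[OF b, symmetric] .
    then show False using subtree_subset edgeD(1)[OF a] edgeD(1)[OF b] zN by blast
  qed
  then show ?thesis unfolding feeder_def using a i by blast
qed

lemma unit_flow_pos:
  assumes j: "j \<in> N" and c: "node_of c \<in> subtree E j"
  shows "0 < flow Active r (unit_at c) (\<lambda>_. 0) j \<or> 0 < flow Reactive x (unit_at c) (\<lambda>_. 0) j"
proof (cases c)
  case (Active k)
  have "0 < (\<Sum>i\<in>subtree E j. unit_at c (Active i))"
    using Active c finite_subtree[OF j] by (intro sum_pos2[of _ k]) (auto simp: unit_at_def)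
  then show ?thesis by (simp add: flow_consumption)
next
  case (Reactive k)
  have "0 < (\<Sum>i\<in>subtree E j. unit_at c (Reactive i))"
    using Reactive c finite_subtree[OF j] by (intro sum_pos2[of _ k]) (auto simp: unit_at_def)
  then show ?thesis by (simp add: flow_consumption)
qed

text \<open>The line from the substation into the feeder lies on the path to \<open>i\<close> and
  carries the consumption at \<open>c\<close>, wherever in the feeder that is; its drop alone is
  positive.\<close>

lemma unit_vdrop_pos:
  assumes "node_of c \<in> feeder z E i" and i: "i \<in> N"
  shows "0 < vdrop (unit_at c) (\<lambda>_. 0) i"
proof -
  obtain a where a: "(z, a) \<in> E" "a \<in> N" "par a = z" "i \<in> subtree E a" "node_of c \<in> subtree E a"
    using assms(1) by (rule feederE)
  have "0 < line_drop (unit_at c) (\<lambda>_. 0) a"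
    unfolding line_drop_def
    using unit_flow_pos[OF a(2,5)] nrpf_flow[OF nrpf_unit1[of c] a(2)] r_pos[OF a(1)] x_pos[OF a(1)] a(3)
    by (auto intro: add_pos_nonneg add_nonneg_pos)
  moreover have "0 \<le> line_drop (unit_at c) (\<lambda>_. 0) k" if "k \<in> anc i" for k
    using line_drop_ge(2)[OF nrpf_unit1[of c], of "\<lambda>_. 0" k] that anc_subset by auto
  ultimately show ?thesis
    unfolding vdrop_def using finite_anc a by (intro sum_pos2[of _ a]) (auto simp: anc_def)
qed

lemma vdrop_strict_mono:
  assumes dd: "(\<lambda>c'. d' c' - d c') = (\<lambda>c'. h * unit_at c c')" and h: "0 < h"
    and le: "\<forall>k\<in>N. y k \<le> y' k" and c: "node_of c \<in> feeder z E i" and i: "i \<in> N"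
  shows "vdrop d y i < vdrop d' y' i"
proof -
  have "0 < h * vdrop (unit_at c) (\<lambda>_. 0) i" using unit_vdrop_pos[OF c i] h by simp
  also have "\<dots> = vdrop (\<lambda>c'. h * unit_at c c') (\<lambda>_. 0) i" using vdrop_scale[of h "unit_at c" "\<lambda>_. 0" i] by simp
  also have "\<dots> \<le> vdrop (\<lambda>c'. h * unit_at c c') (\<lambda>k. y' k - y k) i"
    using vdrop_ge(1)[OF nrpf_unit] h le by simp
  also have "\<dots> = vdrop d' y' i - vdrop d y i" by (simp add: vdrop_diff dd)
  finally show ?thesis by simp
qed

text \<open>A loaded line has a positive current, whose losses feed both the active and the reactive flow
  upstream; hence both flows are positive even if only one kind of power is consumed.\<close>

lemma loaded_flow_pos:
  assumes d: "d \<in> admissible N E M" and j: "j \<in> N" and ld: "loaded d (subtree E j)"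
  shows "0 < flow Active r d (ell d) j" "0 < flow Reactive x d (ell d) j"
proof -
  note n = admissibleD(1)[OF d]
  have l0: "\<forall>k\<in>N. 0 \<le> ell d k" using ell_box[OF d] by auto
  have sub: "k \<in> N" if "k \<in> subtree E j" for k using that subtree_subset[OF j] by auto
  \<comment> \<open>Consumption may cancel at \<open>j\<close>, since NRPF admits negative entries,
    so a line with positive flow is sought in the whole subtree. If there were none, subtracting the
    flows of the children at each node would make every consumption zero.\<close>
  have "\<exists>k\<in>subtree E j. 0 < flow Active r d (\<lambda>_. 0) k \<or> 0 < flow Reactive x d (\<lambda>_. 0) k"
  proof (rule ccontr)
    assume "\<not> ?thesis"
    then have Z: "flow Active r d (\<lambda>_. 0) k = 0" "flow Reactive x d (\<lambda>_. 0) k = 0" if "k \<in> subtree E j" for k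
      using that nrpf_flow[OF n sub[OF that]] by (meson antisym not_less)+
    have "d (Active k) = 0 \<and> d (Reactive k) = 0" if k: "k \<in> subtree E j" for k
    proof -
      have ch: "i \<in> subtree E j" if "(k, i) \<in> E" for i
        using that k by (auto simp: subtree_def intro: rtrancl_into_rtrancl)
      have "(\<Sum>i | (k, i) \<in> E. \<Sum>i'\<in>subtree E i. d (Active i')) = 0"
        "(\<Sum>i | (k, i) \<in> E. \<Sum>i'\<in>subtree E i. d (Reactive i')) = 0"
        using Z[OF ch] by (auto simp: flow_consumption)
      then show ?thesis
        using sum_subtree[OF sub[OF k], of "\<lambda>i. d (Active i)"] sum_subtree[OF sub[OF k], of "\<lambda>i. d (Reactive i)"]
          Z[OF k] by (simp add: flow_consumption)
    qed
    then show False using ld by (auto simp: loaded_def)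
  qed
  then obtain k where k: "k \<in> subtree E j" "0 < flow Active r d (\<lambda>_. 0) k \<or> 0 < flow Reactive x d (\<lambda>_. 0) k"
    by blast
  have kN: "k \<in> N" using sub[OF k(1)] .
  have "0 < flow Active r d (ell d) k \<or> 0 < flow Reactive x d (ell d) k"
    using k(2) flow_ge(1,3)[OF n l0 kN] by linarith
  then have "0 < (flow Active r d (ell d) k)\<^sup>2 + (flow Reactive x d (ell d) k)\<^sup>2"
    by (metis less_irrefl sum_power2_gt_zero_iff)
  then have "ell d k \<noteq> 0" using ell_eq[OF d kN] by auto
  then have "0 < ell d k" using l0 kN by (metis less_eq_real_def)
  then have "0 < r (par k, k) * ell d k" "0 < x (par k, k) * ell d k"
    using r_pos x_pos par_edge[OF kN] by simp_all
  then show "0 < flow Active r d (ell d) j" "0 < flow Reactive x d (ell d) j"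
    using losses_ge[where w = r and C = Active, OF l0 r_pos j k(1)]
      losses_ge[where w = x and C = Reactive, OF l0 x_pos j k(1)]
      flow_split[of Active r d "ell d" j] flow_split[of Reactive x d "ell d" j] nrpf_flow[OF n j, of r] nrpf_flow[OF n j, of x]
    by linarith+
qed

text \<open>An unchanged current contradicts the power balance. If \<open>c\<close> lies below the
  line, the flow of its kind rises strictly while the voltage does not rise; if not, the voltage at
  the parent falls strictly, which a positive current turns into a strict change of the product
  while the flows do not fall.\<close>

lemma ell_strict_mono:
  assumes d: "d \<in> admissible N E M" and d': "d' \<in> admissible N E M"
    and dd: "(\<lambda>c'. d' c' - d c') = (\<lambda>c'. h * unit_at c c')" and h: "0 < h"
    and j: "j \<in> N" and c: "node_of c \<in> feeder z E j"
    and cases: "node_of c \<in> subtree E j \<or> loaded d (subtree E j)"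
  shows "ell d j < ell d' j"
proof (rule ccontr)
  let ?S = "\<lambda>d. (flow Active r d (ell d) j)\<^sup>2 + (flow Reactive x d (ell d) j)\<^sup>2"
  let ?v = "\<lambda>d. V - vdrop d (ell d) (par j)"
  have le: "nrpf N E (\<lambda>c. d' c - d c)" unfolding dd using nrpf_unit h by simp
  have lm: "\<forall>k\<in>N. ell d k \<le> ell d' k" using ell_mono[OF d d' le] .
  assume "\<not> ell d j < ell d' j"
  then have eq: "ell d' j = ell d j" using lm j by fastforce
  have l0: "0 \<le> ell d j" using ell_box[OF d] j by auto
  have E1: "ell d j * ?v d = ?S d" "ell d j * ?v d' = ?S d'"
    using ell_eq[OF d j] ell_eq[OF d' j] eq by auto
  have F: "0 \<le> flow Active r d (ell d) j" "0 \<le> flow Reactive x d (ell d) j"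
    using box_bounds(1,2)[OF d ell_box[OF d] j] by auto
  have mono: "flow Active r d (ell d) j \<le> flow Active r d' (ell d') j"
    "flow Reactive x d (ell d) j \<le> flow Reactive x d' (ell d') j" "?v d' \<le> ?v d"
    using npf_mono[OF d d' le] j by auto
  have SS: "?S d \<le> ?S d'" using mono F by (intro add_mono power_mono) auto
  have vv: "ell d j * ?v d' \<le> ell d j * ?v d" using mono l0 by (intro mult_left_mono) auto
  show False
  proof (cases "node_of c \<in> subtree E j")
    case True
    have A: "h * flow Active r (unit_at c) (\<lambda>_. 0) j \<le> flow Active r d' (ell d') j - flow Active r d (ell d) j"
      "h * flow Reactive x (unit_at c) (\<lambda>_. 0) j \<le> flow Reactive x d' (ell d') j - flow Reactive x d (ell d) j"
      using flow_ge(1,3)[OF le _ j, of "\<lambda>k. ell d' k - ell d k"] lm flow_scale[of _ _ h "unit_at c" "\<lambda>_. 0" j]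
      unfolding flow_diff dd by auto
    have "?S d < ?S d'"
      using unit_flow_pos[OF j True]
    proof
      assume "0 < flow Active r (unit_at c) (\<lambda>_. 0) j"
      then have "0 < h * flow Active r (unit_at c) (\<lambda>_. 0) j" using h by simp
      then have "flow Active r d (ell d) j < flow Active r d' (ell d') j" using A by linarith
      then show ?thesis using mono F by (intro add_less_le_mono power_strict_mono power_mono) auto
    next
      assume "0 < flow Reactive x (unit_at c) (\<lambda>_. 0) j"
      then have "0 < h * flow Reactive x (unit_at c) (\<lambda>_. 0) j" using h by simp
      then have "flow Reactive x d (ell d) j < flow Reactive x d' (ell d') j" using A by linarith
      then show ?thesis using mono F by (intro add_le_less_mono power_strict_mono power_mono) auto
    qed
    then show False using vv E1 by linarith
  next
    case False
    then have ld: "loaded d (subtree E j)" using cases by auto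
    obtain a where a: "(z, a) \<in> E" "a \<in> N" "par a = z" "j \<in> subtree E a" "node_of c \<in> subtree E a"
      using c by (rule feederE)
    \<comment> \<open>This keeps the parent of \<open>j\<close> away from the substation, whose
      voltage is fixed and could not fall.\<close>
    have "j \<noteq> a" using False a by auto
    then have pj: "par j \<in> subtree E a" using a(4) subtree_par by metis
    then have "par j \<in> N" using subtree_subset[OF a(2)] by auto
    moreover have "node_of c \<in> feeder z E (par j)" using feeder_eq[OF a(1) pj] a(5) by simp
    ultimately have v: "vdrop d (ell d) (par j) < vdrop d' (ell d') (par j)"
      using vdrop_strict_mono[OF dd h lm] by blast
    have "0 < ?S d" using loaded_flow_pos[OF d j ld] by (simp add: add_pos_pos)
    then have "ell d j \<noteq> 0" using E1 by auto
    then have "0 < ell d j" using l0 by simp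
    then have "ell d j * ?v d' < ell d j * ?v d" using v by simp
    then show False using SS E1 by linarith
  qed
qed

text \<open>Both kinds of flow rise, whatever the kind of \<open>c\<close>: the current on the line
  rises strictly, and with it both the resistive and the reactive loss of that line.\<close>

lemma npf_flow_strict_mono:
  assumes d: "d \<in> admissible N E M" and d': "d' \<in> admissible N E M"
    and dd: "(\<lambda>c'. d' c' - d c') = (\<lambda>c'. h * unit_at c c')" and h: "0 < h"
    and j: "j \<in> N" and c: "node_of c \<in> feeder z E j"
    and cases: "node_of c \<in> subtree E j \<or> loaded d (subtree E j)"
  shows "flow Active r d (ell d) j < flow Active r d' (ell d') j"
    "flow Reactive x d (ell d) j < flow Reactive x d' (ell d') j"
proof -
  let ?y = "\<lambda>k. ell d' k - ell d k"
  have le: "nrpf N E (\<lambda>c. d' c - d c)" unfolding dd using nrpf_unit h by simp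
  have y: "\<forall>k\<in>N. 0 \<le> ?y k" using ell_mono[OF d d' le] by simp
  have "0 < ?y j" using ell_strict_mono[OF assms] by simp
  then have "0 < r (par j, j) * ?y j" "0 < x (par j, j) * ?y j"
    using r_pos x_pos par_edge[OF j] by simp_all
  then have "0 < flow Active r (\<lambda>c. d' c - d c) ?y j" "0 < flow Reactive x (\<lambda>c. d' c - d c) ?y j"
    using losses_ge[where w = r and C = Active, OF y r_pos j self_in_subtree]
      losses_ge[where w = x and C = Reactive, OF y x_pos j self_in_subtree]
      flow_split[of Active r "\<lambda>c. d' c - d c" ?y j] flow_split[of Reactive x "\<lambda>c. d' c - d c" ?y j]
      nrpf_flow[OF le j, of r] nrpf_flow[OF le j, of x]
    by linarith+
  then show "flow Active r d (ell d) j < flow Active r d' (ell d') j"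
    "flow Reactive x d (ell d) j < flow Reactive x d' (ell d') j"
    using flow_diff[of Active r d' "ell d'" j d "ell d"] flow_diff[of Reactive x d' "ell d'" j d "ell d"] by linarith+
qed

section \<open>Derivatives of NPF and LPF quantities and their comparison\<close>

lemma flow_derivative:
  assumes y: "\<And>k. k \<in> N \<Longrightarrow> ((\<lambda>t. y t k) has_real_derivative m k) (at a within S)" and j: "j \<in> N"
  shows "((\<lambda>t. flow C w (d(c := t)) (y t) j) has_real_derivative flow C w (unit_at c) m j) (at a within S)"
  unfolding flow_def
proof (rule DERIV_sum)
  fix k assume "k \<in> subtree E j"
  then have k: "k \<in> N" using subtree_subset[OF j] by auto
  have "((\<lambda>t. (d(c := t)) (C k)) has_real_derivative unit_at c (C k)) (at a within S)"
    by (cases "C k = c") (auto simp: unit_at_def)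
  then show "((\<lambda>t. (d(c := t)) (C k) + w (par k, k) * y t k) has_real_derivative
      unit_at c (C k) + w (par k, k) * m k) (at a within S)"
    using y[OF k] by (intro DERIV_add DERIV_cmult)
qed

lemma vdrop_derivative:
  assumes y: "\<And>k. k \<in> N \<Longrightarrow> ((\<lambda>t. y t k) has_real_derivative m k) (at a within S)"
  shows "((\<lambda>t. vdrop (d(c := t)) (y t) i) has_real_derivative vdrop (unit_at c) m i) (at a within S)"
  unfolding vdrop_def line_drop_def
proof (rule DERIV_sum)
  fix k assume "k \<in> anc i"
  then have k: "k \<in> N" using anc_subset by auto
  show "((\<lambda>t. 2 * r (par k, k) * flow Active r (d(c := t)) (y t) k + 2 * x (par k, k) * flow Reactive x (d(c := t)) (y t) k
      - ((r (par k, k))\<^sup>2 + (x (par k, k))\<^sup>2) * y t k) has_real_derivative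
      2 * r (par k, k) * flow Active r (unit_at c) m k + 2 * x (par k, k) * flow Reactive x (unit_at c) m k
      - ((r (par k, k))\<^sup>2 + (x (par k, k))\<^sup>2) * m k) (at a within S)"
    using k by (intro DERIV_diff DERIV_add DERIV_cmult flow_derivative y)
qed

text \<open>The quotient rule, regrouped through \<open>lpf_current\<close> so that it matches the
  sensitivity equation of NPF term by term.\<close>

lemma lpf_current_derivative:
  assumes d: "d \<in> admissible N E M" and j: "j \<in> N"
  shows "((\<lambda>t. lpf_current (d(c := t)) j) has_real_derivative
    (2 * flow Active r d (\<lambda>_. 0) j * flow Active r (unit_at c) (\<lambda>_. 0) j
     + 2 * flow Reactive x d (\<lambda>_. 0) j * flow Reactive x (unit_at c) (\<lambda>_. 0) j
     + lpf_current d j * vdrop (unit_at c) (\<lambda>_. 0) (par j)) / (V - vdrop d (\<lambda>_. 0) (par j))) (at (d c) within T)"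
proof -
  have nz: "V - vdrop d (\<lambda>_. 0) (par j) \<noteq> 0" using box_bounds(3)[OF d zero_box, of "par j"] V by linarith
  have z: "((\<lambda>t. (\<lambda>_. 0) k) has_real_derivative (\<lambda>_. 0) k) (at (d c) within T)" for k :: 'n by simp
  show ?thesis
    unfolding lpf_current_def
    by (rule derivative_eq_intros flow_derivative[OF z j] vdrop_derivative[OF z] refl)+
      (use nz in \<open>auto simp: field_simps power2_eq_square\<close>)
qed

text \<open>Each factor in the numerator for LPF is dominated by the one for NPF, all factors being
  nonnegative, and the voltage in the denominator is larger for LPF.\<close>

lemma sensitivity_ge_lpf:
  assumes d: "d \<in> admissible N E M" and m0: "\<forall>k\<in>N. 0 \<le> m k" and e: "nrpf N E e" and j: "j \<in> N"
    and m: "(V - vdrop d (ell d) (par j)) * m j =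
      2 * flow Active r d (ell d) j * flow Active r e m j + 2 * flow Reactive x d (ell d) j * flow Reactive x e m j
      + ell d j * vdrop e m (par j)"
  shows "(2 * flow Active r d (\<lambda>_. 0) j * flow Active r e (\<lambda>_. 0) j
     + 2 * flow Reactive x d (\<lambda>_. 0) j * flow Reactive x e (\<lambda>_. 0) j
     + lpf_current d j * vdrop e (\<lambda>_. 0) (par j)) / (V - vdrop d (\<lambda>_. 0) (par j)) \<le> m j" (is "?a / ?b \<le> _")
    and "0 \<le> (2 * flow Active r d (\<lambda>_. 0) j * flow Active r e (\<lambda>_. 0) j
     + 2 * flow Reactive x d (\<lambda>_. 0) j * flow Reactive x e (\<lambda>_. 0) j
     + lpf_current d j * vdrop e (\<lambda>_. 0) (par j)) / (V - vdrop d (\<lambda>_. 0) (par j))"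
proof -
  note n = admissibleD(1)[OF d]
  have l0: "\<forall>k\<in>N. 0 \<le> ell d k" using ell_box[OF d] by auto
  let ?v = "V - vdrop d (ell d) (par j)"
  have v: "0 < ?v" using box_bounds(3)[OF d ell_box[OF d], of "par j"] V by linarith
  have b: "?v \<le> ?b" using vdrop_ge(1)[OF n l0, of "par j"] by simp
  have fd: "0 \<le> flow Active r d (\<lambda>_. 0) j" "0 \<le> flow Reactive x d (\<lambda>_. 0) j"
    "0 \<le> flow Active r e (\<lambda>_. 0) j" "0 \<le> flow Reactive x e (\<lambda>_. 0) j"
    using nrpf_flow[OF n j] nrpf_flow[OF e j] by auto
  have a: "0 \<le> ?a"
    using fd lpf_current_le_ell(2)[OF d j] vdrop_ge(2)[OF e m0] by simp
  then show "0 \<le> ?a / ?b" using v b by (intro divide_nonneg_nonneg) auto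
  have "?a \<le> ?v * m j"
    unfolding m using fd flow_ge[OF n l0 j] flow_ge[OF e m0 j] lpf_current_le_ell[OF d j] vdrop_ge[OF e m0, of "par j"]
    by (intro add_mono mult_mono) auto
  then have "?a / ?b \<le> (?v * m j) / ?v" using a v b by (intro frac_le) auto
  then show "?a / ?b \<le> m j" using v by simp
qed

text \<open>It suffices to find one line on the path with positive \<open>m\<close>. The line into
  the feeder has it: both of its flows are positive by the load, and one of them responds to
  \<open>c\<close>. The surplus of \<open>line_drop_ge\<close> then makes its drop strictly
  larger.\<close>

lemma vdrop_sensitivity_strict:
  assumes d: "d \<in> admissible N E M" and m0: "\<forall>k\<in>N. 0 \<le> m k"
    and m: "\<And>j. j \<in> N \<Longrightarrow> (V - vdrop d (ell d) (par j)) * m j =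
      2 * flow Active r d (ell d) j * flow Active r (unit_at c) m j
      + 2 * flow Reactive x d (ell d) j * flow Reactive x (unit_at c) m j
      + ell d j * vdrop (unit_at c) m (par j)"
    and i: "i \<in> N" and c: "node_of c \<in> feeder z E i" and ld: "loaded d (feeder z E i)"
  shows "vdrop (unit_at c) (\<lambda>_. 0) i < vdrop (unit_at c) m i"
proof -
  obtain a where a: "(z, a) \<in> E" "a \<in> N" "par a = z" "i \<in> subtree E a" "node_of c \<in> subtree E a"
    using c by (rule feederE)
  have P: "0 < flow Active r d (ell d) a" "0 < flow Reactive x d (ell d) a"
    using loaded_flow_pos[OF d a(2)] ld feeder_eq[OF a(1,4)] by auto
  have u: "0 < flow Active r (unit_at c) m a \<or> 0 < flow Reactive x (unit_at c) m a"
    using unit_flow_pos[OF a(2,5)] flow_ge(1,3)[OF nrpf_unit1[of c] m0 a(2)] by linarith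
  have "0 < 2 * flow Active r d (ell d) a * flow Active r (unit_at c) m a
      + 2 * flow Reactive x d (ell d) a * flow Reactive x (unit_at c) m a"
    using P u flow_ge(2,4)[OF nrpf_unit1[of c] m0 a(2)] by (auto intro: add_pos_nonneg add_nonneg_pos)
  moreover have "0 \<le> ell d a * vdrop (unit_at c) m (par a)"
    using ell_box[OF d] a(2) vdrop_ge(3)[OF nrpf_unit1 m0] by simp
  ultimately have "(V - vdrop d (ell d) (par a)) * m a > 0" unfolding m[OF a(2)] by linarith
  then have "m a \<noteq> 0" by auto
  then have "0 < m a" using m0 a(2) by (metis less_eq_real_def)
  moreover have "0 < (r (par a, a))\<^sup>2 + (x (par a, a))\<^sup>2" using r_pos[OF a(1)] a(3) by (simp add: add_pos_nonneg)
  ultimately have "0 < ((r (par a, a))\<^sup>2 + (x (par a, a))\<^sup>2) * m a" by (rule mult_pos_pos[rotated])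
  then have "line_drop (unit_at c) (\<lambda>_. 0) a < line_drop (unit_at c) m a"
    using line_drop_ge(1)[OF nrpf_unit1[of c] m0 a(2)] by linarith
  moreover have "a \<in> anc i" using a by (simp add: anc_def)
  moreover have "\<forall>k\<in>anc i. line_drop (unit_at c) (\<lambda>_. 0) k \<le> line_drop (unit_at c) m k"
    using line_drop_mono(1)[OF nrpf_unit1 m0] anc_subset by blast
  ultimately show ?thesis
    unfolding vdrop_def using sum_strict_mono_ex1[OF finite_anc] by blast
qed

end

section \<open>Choice of the impedance bound and assembly of the result\<close>

lemma small_network_exists:
  fixes M V :: real
  assumes "radial_network N z E" "0 < V"
  shows "\<exists>\<epsilon>>0. \<exists>K L \<kappa>. \<forall>r x. (\<forall>e\<in>E. 0 < r e \<and> r e < \<epsilon> \<and> 0 < x e \<and> x e < \<epsilon>) \<longrightarrow>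
    small_network N z E r x V M K L \<epsilon> \<kappa>"
proof -
  define K where "K = real (card N) * \<bar>M\<bar>"
  define L where "L = 4 * (K + 1)\<^sup>2 / V"
  define D where "D = 4 * (K + 1) + L"
  \<comment> \<open>The minimum combines the two smallness conditions of the locale; adding 1 to the
    number of nodes avoids a zero denominator for an empty network.\<close>
  define \<epsilon> where "\<epsilon> = min 1 (V / 4) / (6 * (real (card N) + 1) * D)"
  define \<kappa> where "\<kappa> = 6 * real (card N) * \<epsilon>"
  have K0: "0 \<le> K" by (simp add: K_def)
  have "0 \<le> L" using assms(2) by (simp add: L_def)
  then have D: "0 < D" using K0 by (simp add: D_def)
  then have e: "0 < \<epsilon>" using assms(2) by (simp add: \<epsilon>_def)
  have eq: "6 * (real (card N) + 1) * D * \<epsilon> = min 1 (V / 4)"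
    using D by (simp add: \<epsilon>_def)
  have "\<kappa> * D = 6 * real (card N) * (D * \<epsilon>)" by (simp add: \<kappa>_def)
  also have "\<dots> \<le> 6 * (real (card N) + 1) * (D * \<epsilon>)" using D e by (intro mult_right_mono) auto
  finally have "\<kappa> * D \<le> min 1 (V / 4)" using eq by (simp add: mult.assoc)
  then have "small_network N z E r x V M K L \<epsilon> \<kappa>"
    if "\<forall>e\<in>E. 0 < r e \<and> r e < \<epsilon> \<and> 0 < x e \<and> x e < \<epsilon>" for r x
    using that assms e by unfold_locales (auto simp: K_def L_def \<kappa>_def D_def)
  then show ?thesis using e by blast
qed

theorem proposition1:
  fixes N :: "'n set" and z :: 'n and E :: "('n \<times> 'n) set" and vnom dv W M :: real
  assumes "radial_network N z E" and "0 \<le> dv" and "dv < vnom" and "0 \<le> W"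
  shows "\<exists>\<epsilon>>0. \<forall>r x :: 'n \<times> 'n \<Rightarrow> real.
    (\<forall>e\<in>E. 0 < r e \<and> r e < \<epsilon> \<and> 0 < x e \<and> x e < \<epsilon>) \<longrightarrow>
    (let NPF = npf_state N z E r x vnom dv W; LPF = lpf_state z E r x vnom dv in
     \<forall>d \<in> admissible N E M.
       npf_solution N z E r x vnom dv W d (NPF d) \<and>
       npf_constraints z E r x (vnom - dv) d (NPF d) \<and>
       lpf_constraints z E r x (vnom - dv) d (LPF d) \<and>
       (\<forall>c. node_of c \<in> N \<longrightarrow>
         (let T = {t. d(c := t) \<in> admissible N E M} in
          (\<forall>(i, j)\<in>E. \<forall>F\<in>{flowP, flowQ, curr}.
             mono_on T (\<lambda>t. F (NPF (d(c := t))) (i, j)) \<and>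
             mono_on T (\<lambda>t. F (LPF (d(c := t))) (i, j)) \<and>
             (node_of c \<in> feeder z E j \<and> (node_of c \<in> subtree E j \<or> loaded d (subtree E j)) \<longrightarrow>
                strict_mono_on T (\<lambda>t. F (NPF (d(c := t))) (i, j)))) \<and>
          (\<forall>i\<in>N.
             antimono_on T (\<lambda>t. volt (NPF (d(c := t))) i) \<and>
             antimono_on T (\<lambda>t. volt (LPF (d(c := t))) i) \<and>
             (node_of c \<in> feeder z E i \<longrightarrow>
                strict_antimono_on T (\<lambda>t. volt (NPF (d(c := t))) i) \<and>
                strict_antimono_on T (\<lambda>t. volt (LPF (d(c := t))) i))) \<and>
          (\<forall>e\<in>E. \<forall>F\<in>{flowP, flowQ, curr}. \<exists>f' g'.
             ((\<lambda>t. F (NPF (d(c := t))) e) has_real_derivative f') (at (d c) within T) \<and>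
             ((\<lambda>t. F (LPF (d(c := t))) e) has_real_derivative g') (at (d c) within T) \<and>
             f' \<ge> g' \<and> g' \<ge> 0) \<and>
          (\<forall>i\<in>N. \<exists>v' w'.
             ((\<lambda>t. volt (NPF (d(c := t))) i) has_real_derivative v') (at (d c) within T) \<and>
             ((\<lambda>t. volt (LPF (d(c := t))) i) has_real_derivative w') (at (d c) within T) \<and>
             0 \<ge> w' \<and> w' \<ge> v' \<and>
             (node_of c \<in> feeder z E i \<longrightarrow> 0 > w') \<and>
             (node_of c \<in> feeder z E i \<and> loaded d (feeder z E i) \<longrightarrow> w' > v')))))"
proof -
  define V where "V = vnom - dv"
  have "0 < V" using assms(3) by (simp add: V_def)
  then obtain \<epsilon> K L \<kappa> where eps: "0 < \<epsilon>"
    and small: "\<And>r x. (\<forall>e\<in>E. 0 < r e \<and> r e < \<epsilon> \<and> 0 < x e \<and> x e < \<epsilon>) \<Longrightarrow> small_network N z E r x V M K L \<epsilon> \<kappa>"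
    using small_network_exists[OF assms(1), of V M] by blast
  show ?thesis
    unfolding Let_def V_def[symmetric]
  proof (intro exI[of _ \<epsilon>] conjI eps allI impI)
    fix r x :: "'n \<times> 'n \<Rightarrow> real"
    assume "\<forall>e\<in>E. 0 < r e \<and> r e < \<epsilon> \<and> 0 < x e \<and> x e < \<epsilon>"
    then interpret small_network N z E r x V M K L \<epsilon> \<kappa> by (rule small)
    let ?A = "admissible N E M"
    define NPF where "NPF = npf_state N z E r x vnom dv W"
    define LPF where "LPF = lpf_state z E r x vnom dv"
    note V = V_def[symmetric]
    have sol: "npf_solution N z E r x vnom dv W d (NPF d)" if "d \<in> ?A" for d
      unfolding NPF_def by (rule npf_state_solution[OF that V assms(2,4)])
    have con: "npf_constraints z E r x V d (NPF d)" if "d \<in> ?A" for d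
      by (rule npf_solution_constraints[OF that V assms(2,4) sol[OF that]])
    have lin: "lpf_constraints z E r x V d (LPF d)" if "d \<in> ?A" for d
      unfolding LPF_def lpf_state_def V by (rule lpf_state_constraints[OF that])
    note nE = npf_solution_unique(1)[OF _ V assms(2,4) sol] and nV = npf_solution_unique(2)[OF _ V assms(2,4) sol]
      and lE = lpf_unique(1)[OF _ lin] and lV = lpf_unique(2)[OF _ lin]
    show "\<forall>d\<in>?A.
       npf_solution N z E r x vnom dv W d (npf_state N z E r x vnom dv W d) \<and>
       npf_constraints z E r x V d (npf_state N z E r x vnom dv W d) \<and>
       lpf_constraints z E r x V d (lpf_state z E r x vnom dv d) \<and>
       (\<forall>c. node_of c \<in> N \<longrightarrow>
          (\<forall>(i, j)\<in>E. \<forall>F\<in>{flowP, flowQ, curr}.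
             mono_on {t. d(c := t) \<in> ?A} (\<lambda>t. F (npf_state N z E r x vnom dv W (d(c := t))) (i, j)) \<and>
             mono_on {t. d(c := t) \<in> ?A} (\<lambda>t. F (lpf_state z E r x vnom dv (d(c := t))) (i, j)) \<and>
             (node_of c \<in> feeder z E j \<and> (node_of c \<in> subtree E j \<or> loaded d (subtree E j)) \<longrightarrow>
                strict_mono_on {t. d(c := t) \<in> ?A} (\<lambda>t. F (npf_state N z E r x vnom dv W (d(c := t))) (i, j)))) \<and>
          (\<forall>i\<in>N.
             antimono_on {t. d(c := t) \<in> ?A} (\<lambda>t. volt (npf_state N z E r x vnom dv W (d(c := t))) i) \<and>
             antimono_on {t. d(c := t) \<in> ?A} (\<lambda>t. volt (lpf_state z E r x vnom dv (d(c := t))) i) \<and>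
             (node_of c \<in> feeder z E i \<longrightarrow>
                strict_antimono_on {t. d(c := t) \<in> ?A} (\<lambda>t. volt (npf_state N z E r x vnom dv W (d(c := t))) i) \<and>
                strict_antimono_on {t. d(c := t) \<in> ?A} (\<lambda>t. volt (lpf_state z E r x vnom dv (d(c := t))) i))) \<and>
          (\<forall>e\<in>E. \<forall>F\<in>{flowP, flowQ, curr}. \<exists>f' g'.
             ((\<lambda>t. F (npf_state N z E r x vnom dv W (d(c := t))) e) has_real_derivative f') (at (d c) within {t. d(c := t) \<in> ?A}) \<and>
             ((\<lambda>t. F (lpf_state z E r x vnom dv (d(c := t))) e) has_real_derivative g') (at (d c) within {t. d(c := t) \<in> ?A}) \<and>
             f' \<ge> g' \<and> g' \<ge> 0) \<and>
          (\<forall>i\<in>N. \<exists>v' w'.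
             ((\<lambda>t. volt (npf_state N z E r x vnom dv W (d(c := t))) i) has_real_derivative v') (at (d c) within {t. d(c := t) \<in> ?A}) \<and>
             ((\<lambda>t. volt (lpf_state z E r x vnom dv (d(c := t))) i) has_real_derivative w') (at (d c) within {t. d(c := t) \<in> ?A}) \<and>
             0 \<ge> w' \<and> w' \<ge> v' \<and>
             (node_of c \<in> feeder z E i \<longrightarrow> 0 > w') \<and>
             (node_of c \<in> feeder z E i \<and> loaded d (feeder z E i) \<longrightarrow> w' > v')))"
      unfolding NPF_def[symmetric] LPF_def[symmetric]
    proof (intro ballI conjI sol con lin allI impI)
      fix d c assume d: "d \<in> ?A" and c: "node_of c \<in> N"
      define T where "T = {t. d(c := t) \<in> ?A}"
      have TD: "d(c := t) \<in> ?A" if "t \<in> T" for t using that by (simp add: T_def)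
      have dT: "d c \<in> T" using d by (simp add: T_def)
      have incr: "nrpf N E (\<lambda>c'. (d(c := t)) c' - (d(c := s)) c')" if "s \<le> t" for s t
        unfolding upd_diff using that by (intro nrpf_unit) simp
      \<comment> \<open>A single sensitivity vector for the pair \<open>d\<close>, \<open>c\<close>
        supplies the derivatives at all lines and nodes.\<close>
      obtain m where m0: "\<forall>j\<in>N. 0 \<le> m j"
        and m: "\<And>j. j \<in> N \<Longrightarrow> (V - vdrop d (ell d) (par j)) * m j =
          2 * flow Active r d (ell d) j * flow Active r (unit_at c) m j
          + 2 * flow Reactive x d (ell d) j * flow Reactive x (unit_at c) m j
          + ell d j * vdrop (unit_at c) m (par j)"
        using sensitivity_exists[OF d nrpf_unit1[of c]] by blast
      have m': "((\<lambda>t. ell (d(c := t)) j) has_real_derivative m j) (at (d c) within T)" if "j \<in> N" for j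
        using ell_derivative[OF d m TD that] .
      have zero': "((\<lambda>t. 0) has_real_derivative 0) (at (d c) within T)" by simp
      show "case ij of (i, j) \<Rightarrow> \<forall>F\<in>{flowP, flowQ, curr}.
             mono_on {t. d(c := t) \<in> ?A} (\<lambda>t. F (NPF (d(c := t))) (i, j)) \<and>
             mono_on {t. d(c := t) \<in> ?A} (\<lambda>t. F (LPF (d(c := t))) (i, j)) \<and>
             (node_of c \<in> feeder z E j \<and> (node_of c \<in> subtree E j \<or> loaded d (subtree E j)) \<longrightarrow>
                strict_mono_on {t. d(c := t) \<in> ?A} (\<lambda>t. F (NPF (d(c := t))) (i, j)))"
        if "ij \<in> E" for ij
      proof (cases ij)
        case (Pair i j)
        with that have ij: "(i, j) \<in> E" by simp
        have j: "j \<in> N" using edgeD(1)[OF ij] .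
        have "mono_on T (\<lambda>t. F (NPF (d(c := t))) (i, j)) \<and> mono_on T (\<lambda>t. F (LPF (d(c := t))) (i, j)) \<and>
            (node_of c \<in> feeder z E j \<and> (node_of c \<in> subtree E j \<or> loaded d (subtree E j)) \<longrightarrow>
                strict_mono_on T (\<lambda>t. F (NPF (d(c := t))) (i, j)))"
          if F: "F = flowP \<or> F = flowQ \<or> F = curr" for F
        proof (intro conjI impI)
          show "mono_on T (\<lambda>t. F (NPF (d(c := t))) (i, j))"
          proof (rule mono_onI)
            fix s t assume st: "s \<in> T" "t \<in> T" "s \<le> t"
            note a = TD[OF st(1)] TD[OF st(2)] incr[OF st(3)]
            show "F (NPF (d(c := s))) (i, j) \<le> F (NPF (d(c := t))) (i, j)"
              using F nE[OF a(1) a(1) ij] nE[OF a(2) a(2) ij] npf_mono(1,2)[of "d(c := s)" "d(c := t)", OF a j] ell_mono[of "d(c := s)" "d(c := t)", OF a] j by auto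
          qed
          show "mono_on T (\<lambda>t. F (LPF (d(c := t))) (i, j))"
          proof (rule mono_onI)
            fix s t assume st: "s \<in> T" "t \<in> T" "s \<le> t"
            note a = TD[OF st(1)] TD[OF st(2)] incr[OF st(3)]
            show "F (LPF (d(c := s))) (i, j) \<le> F (LPF (d(c := t))) (i, j)"
              using F lE[OF a(1) a(1) ij] lE[OF a(2) a(2) ij] flow_mono[where d = "d(c := s)" and d' = "d(c := t)" and y = "\<lambda>_. 0" and y' = "\<lambda>_. 0", OF a(3) _ j] lpf_mono[of "d(c := s)" "d(c := t)", OF a j] by auto
          qed
          show "strict_mono_on T (\<lambda>t. F (NPF (d(c := t))) (i, j))"
            if fd: "node_of c \<in> feeder z E j \<and> (node_of c \<in> subtree E j \<or> loaded d (subtree E j))"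
          proof (rule strict_mono_onI)
            fix s t assume st: "s \<in> T" "t \<in> T" "s < t"
            note a = TD[OF st(1)] TD[OF st(2)]
            have h: "0 < t - s" using st by simp
            \<comment> \<open>The load condition has to be moved from \<open>d\<close> to
              \<open>d(c := s)\<close>. Outside the subtree the update leaves its consumption
              untouched, and inside it the first alternative holds.\<close>
            have ld: "node_of c \<in> subtree E j \<or> loaded (d(c := s)) (subtree E j)"
              using fd by (auto simp: loaded_def)
            note b = a upd_diff[of d c t s] h j fd[THEN conjunct1] ld
            show "F (NPF (d(c := s))) (i, j) < F (NPF (d(c := t))) (i, j)"
              using F nE[OF a(1) a(1) ij] nE[OF a(2) a(2) ij] npf_flow_strict_mono[of "d(c := s)" "d(c := t)", OF b] ell_strict_mono[of "d(c := s)" "d(c := t)", OF b] by auto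
          qed
        qed
        then show ?thesis unfolding Pair T_def by blast
      qed
      show "\<exists>f' g'. ((\<lambda>t. F (NPF (d(c := t))) e) has_real_derivative f') (at (d c) within {t. d(c := t) \<in> ?A}) \<and>
             ((\<lambda>t. F (LPF (d(c := t))) e) has_real_derivative g') (at (d c) within {t. d(c := t) \<in> ?A}) \<and>
             f' \<ge> g' \<and> g' \<ge> 0"
        if e: "e \<in> E" and F: "F \<in> {flowP, flowQ, curr}" for e F
      proof -
        obtain i j where ij: "e = (i, j)" "(i, j) \<in> E" using e by (cases e) auto
        have j: "j \<in> N" using edgeD(1)[OF ij(2)] .
        note n = nE[OF TD TD ij(2)] and l = lE[OF TD TD ij(2)]
        note cong = has_real_derivative_cong_on[OF _ dT]
        from F consider "F = flowP" | "F = flowQ" | "F = curr" by blast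
        then have "\<exists>f' g'. ((\<lambda>t. F (NPF (d(c := t))) e) has_real_derivative f') (at (d c) within T) \<and>
             ((\<lambda>t. F (LPF (d(c := t))) e) has_real_derivative g') (at (d c) within T) \<and> f' \<ge> g' \<and> g' \<ge> 0"
        proof cases
          case 1
          have "((\<lambda>t. flowP (NPF (d(c := t))) (i, j)) has_real_derivative flow Active r (unit_at c) m j) (at (d c) within T)"
            by (rule cong[OF flow_derivative[OF m' j, where d = d]]) (simp_all add: n)
          moreover have "((\<lambda>t. flowP (LPF (d(c := t))) (i, j)) has_real_derivative flow Active r (unit_at c) (\<lambda>_. 0) j) (at (d c) within T)"
            by (rule cong[OF flow_derivative[OF zero' j, where d = d]]) (simp_all add: l)
          ultimately show ?thesis
            unfolding 1 ij(1) using flow_ge(1)[OF nrpf_unit1 m0 j] nrpf_flow(1)[OF nrpf_unit1 j] by blast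
        next
          case 2
          have "((\<lambda>t. flowQ (NPF (d(c := t))) (i, j)) has_real_derivative flow Reactive x (unit_at c) m j) (at (d c) within T)"
            by (rule cong[OF flow_derivative[OF m' j, where d = d]]) (simp_all add: n)
          moreover have "((\<lambda>t. flowQ (LPF (d(c := t))) (i, j)) has_real_derivative flow Reactive x (unit_at c) (\<lambda>_. 0) j) (at (d c) within T)"
            by (rule cong[OF flow_derivative[OF zero' j, where d = d]]) (simp_all add: l)
          ultimately show ?thesis
            unfolding 2 ij(1) using flow_ge(3)[OF nrpf_unit1 m0 j] nrpf_flow(2)[OF nrpf_unit1 j] by blast
        next
          case 3
          have "((\<lambda>t. curr (NPF (d(c := t))) (i, j)) has_real_derivative m j) (at (d c) within T)"
            by (rule cong[OF m'[OF j]]) (simp_all add: n)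
          moreover note has_real_derivative_cong_on[where g = "\<lambda>t. curr (LPF (d(c := t))) (i, j)", OF lpf_current_derivative[OF d j] dT]
          ultimately show ?thesis
            unfolding 3 ij(1) using l sensitivity_ge_lpf[OF d m0 nrpf_unit1 j m[OF j]] by metis
        qed
        then show ?thesis unfolding T_def .
      qed
      fix i assume i: "i \<in> N"
      then have iN: "i \<in> insert z N" by simp
      note n = nV[OF TD TD iN] and l = lV[OF TD TD iN]
      have "antimono_on T (\<lambda>t. volt (NPF (d(c := t))) i)"
      proof (rule monotone_onI)
        fix s t assume st: "s \<in> T" "t \<in> T" "s \<le> t"
        show "volt (NPF (d(c := t))) i \<le> volt (NPF (d(c := s))) i"
          using n[OF st(1) st(1)] n[OF st(2) st(2)] npf_mono(3)[of "d(c := s)" "d(c := t)", OF TD[OF st(1)] TD[OF st(2)] incr[OF st(3)], where i = i] by simp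
      qed
      then show "antimono_on {t. d(c := t) \<in> ?A} (\<lambda>t. volt (NPF (d(c := t))) i)" unfolding T_def .
      have "antimono_on T (\<lambda>t. volt (LPF (d(c := t))) i)"
      proof (rule monotone_onI)
        fix s t assume st: "s \<in> T" "t \<in> T" "s \<le> t"
        show "volt (LPF (d(c := t))) i \<le> volt (LPF (d(c := s))) i"
          using l[OF st(1) st(1)] l[OF st(2) st(2)] vdrop_mono[where d = "d(c := s)" and d' = "d(c := t)" and y = "\<lambda>_. 0" and y' = "\<lambda>_. 0" and i = i, OF incr[OF st(3)]] by simp
      qed
      then show "antimono_on {t. d(c := t) \<in> ?A} (\<lambda>t. volt (LPF (d(c := t))) i)" unfolding T_def .
      show "strict_antimono_on {t. d(c := t) \<in> ?A} (\<lambda>t. volt (NPF (d(c := t))) i)"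
        if fd: "node_of c \<in> feeder z E i"
        unfolding T_def[symmetric]
      proof (rule monotone_onI)
        fix s t assume st: "s \<in> T" "t \<in> T" "s < t"
        have lm: "\<forall>k\<in>N. ell (d(c := s)) k \<le> ell (d(c := t)) k"
          using ell_mono[of "d(c := s)" "d(c := t)", OF TD[OF st(1)] TD[OF st(2)] incr] st(3) by simp
        show "volt (NPF (d(c := t))) i < volt (NPF (d(c := s))) i"
          using n[OF st(1) st(1)] n[OF st(2) st(2)] vdrop_strict_mono[where d = "d(c := s)" and d' = "d(c := t)", OF upd_diff[of d c t s] _ lm fd i] st(3) by simp
      qed
      show "strict_antimono_on {t. d(c := t) \<in> ?A} (\<lambda>t. volt (LPF (d(c := t))) i)"
        if fd: "node_of c \<in> feeder z E i"
        unfolding T_def[symmetric]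
      proof (rule monotone_onI)
        fix s t assume st: "s \<in> T" "t \<in> T" "s < t"
        show "volt (LPF (d(c := t))) i < volt (LPF (d(c := s))) i"
          using l[OF st(1) st(1)] l[OF st(2) st(2)] vdrop_strict_mono[where d = "d(c := s)" and d' = "d(c := t)" and y = "\<lambda>_. 0" and y' = "\<lambda>_. 0", OF upd_diff[of d c t s] _ _ fd i] st(3) by simp
      qed
      have Vd: "((\<lambda>t. V - f t) has_real_derivative - D) (at (d c) within T)"
        if "(f has_real_derivative D) (at (d c) within T)" for f D
        using DERIV_diff[OF DERIV_const that] by simp
      show "\<exists>v' w'. ((\<lambda>t. volt (NPF (d(c := t))) i) has_real_derivative v') (at (d c) within {t. d(c := t) \<in> ?A}) \<and>
             ((\<lambda>t. volt (LPF (d(c := t))) i) has_real_derivative w') (at (d c) within {t. d(c := t) \<in> ?A}) \<and>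
             0 \<ge> w' \<and> w' \<ge> v' \<and>
             (node_of c \<in> feeder z E i \<longrightarrow> 0 > w') \<and>
             (node_of c \<in> feeder z E i \<and> loaded d (feeder z E i) \<longrightarrow> w' > v')"
        unfolding T_def[symmetric]
      proof (intro exI conjI impI)
        show "((\<lambda>t. volt (NPF (d(c := t))) i) has_real_derivative - vdrop (unit_at c) m i) (at (d c) within T)"
          by (rule has_real_derivative_cong_on[OF Vd[OF vdrop_derivative[OF m', where d = d]] dT]) (use n in auto)
        show "((\<lambda>t. volt (LPF (d(c := t))) i) has_real_derivative - vdrop (unit_at c) (\<lambda>_. 0) i) (at (d c) within T)"
          by (rule has_real_derivative_cong_on[OF Vd[OF vdrop_derivative[OF zero', where d = d]] dT]) (use l in auto)
        show "- vdrop (unit_at c) m i < - vdrop (unit_at c) (\<lambda>_. 0) i"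
          if "node_of c \<in> feeder z E i \<and> loaded d (feeder z E i)"
          using vdrop_sensitivity_strict[OF d m0 m i] that by simp
      qed (use vdrop_ge[OF nrpf_unit1[of c] m0, of i] unit_vdrop_pos[OF _ i, of c] in auto)
    qed
  qed
qed

end
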